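(* For every integer $k\ge 1$ and every integer $n\ge 0$, $$B_3\big(2^{k+1}n+2^k-1\big)\equiv 0 \pmod{\frac{2^{2k+2}+(-1)^k}{5}}.$$
   Context: A partition is a 3-core if none of its hook numbers is a multiple of 3 (the empty partition is a 3-core). For an integer $n\ge 0$, $B_3(n)$ denotes the number of partition triples of $n$ with 3-cores, i.e. ordered triples $(\lambda_1,\lambda_2,\lambda_3)$ of (possibly empty) partitions, each a 3-core, such that the sum of all the parts of $\lambda_1,\lambda_2,\lambda_3$ equals $n$; in particular $B_3(0)=1$. Equivalently (a standard fact recalled in the paper), $\sum_{n\ge 0}B_3(n)q^n=\dfrac{f_3^9}{f_1^3}$, where $f_k=\prod_{m=1}^{\infty}(1-q^{km})$. The modulus $\frac{2^{2k+2}+(-1)^k}{5}$ is a positive integer for every $k\ge1$. *)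

theory Defs
  imports "HOL-Number_Theory.Cong"
begin

text \<open>A partition is the list of its (positive) parts in weakly decreasing order.\<close>

definition is_partition :: "nat list \<Rightarrow> bool" where
  "is_partition xs \<longleftrightarrow> sorted_wrt (\<ge>) xs \<and> 0 \<notin> set xs"

text \<open>Cells of the Young diagram are indexed from zero: row \<open>i\<close>, column \<open>j\<close>.\<close>

definition cells :: "nat list \<Rightarrow> (nat \<times> nat) set" where
  "cells xs = {(i, j). i < length xs \<and> j < xs ! i}"

definition arm_length :: "nat list \<Rightarrow> nat \<Rightarrow> nat \<Rightarrow> nat" where
  "arm_length xs i j = card {j'. j < j' \<and> (i, j') \<in> cells xs}"

definition leg_length :: "nat list \<Rightarrow> nat \<Rightarrow> nat \<Rightarrow> nat" where
  "leg_length xs i j = card {i'. i < i' \<and> (i', j) \<in> cells xs}"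

definition hook_number :: "nat list \<Rightarrow> nat \<Rightarrow> nat \<Rightarrow> nat" where
  "hook_number xs i j = arm_length xs i j + leg_length xs i j + 1"

definition is_core :: "nat \<Rightarrow> nat list \<Rightarrow> bool" where
  "is_core t xs \<longleftrightarrow>
     is_partition xs \<and> (\<forall>(i, j) \<in> cells xs. \<not> t dvd hook_number xs i j)"

definition core_triples :: "nat \<Rightarrow> nat \<Rightarrow> (nat list \<times> nat list \<times> nat list) set" where
  "core_triples t n = {(xs, ys, zs). is_core t xs \<and> is_core t ys \<and> is_core t zs \<and>
                         sum_list xs + sum_list ys + sum_list zs = n}"

definition B3 :: "nat \<Rightarrow> nat" where
  "B3 n = card (core_triples 3 n)"

text \<open>The set counted by \<open>B3\<close> is finite, so \<open>card\<close> is an honest count.\<close>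

lemma length_le_sum_list:
  "0 \<notin> set xs \<Longrightarrow> length xs \<le> sum_list (xs :: nat list)"
  by (induction xs) auto

lemma finite_core_triples: "finite (core_triples t n)"
proof -
  let ?L = "{xs. set xs \<subseteq> {..n} \<and> length xs \<le> n}"
  have bound: "xs \<in> ?L" if "is_core t xs" "sum_list xs \<le> n" for xs
    using that length_le_sum_list[of xs] member_le_sum_list[of _ xs]
    by (fastforce simp: is_core_def is_partition_def)
  have "core_triples t n \<subseteq> ?L \<times> ?L \<times> ?L"
  proof
    fix p assume "p \<in> core_triples t n"
    then obtain xs ys zs where p: "p = (xs, ys, zs)"
      and c: "is_core t xs" "is_core t ys" "is_core t zs"
      and s: "sum_list xs + sum_list ys + sum_list zs = n"
      by (auto simp: core_triples_def)
    from s have "sum_list xs \<le> n" "sum_list ys \<le> n" "sum_list zs \<le> n" by linarith+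
    with p c bound show "p \<in> ?L \<times> ?L \<times> ?L" by blast
  qed
  moreover have "finite ?L" by (rule finite_lists_length_le) simp
  ultimately show ?thesis by (meson finite_SigmaI finite_subset)
qed

text \<open>The division in the modulus is exact.\<close>

lemma five_dvd_modulus: "(5 :: int) dvd 2 ^ (2 * k + 2) + (-1) ^ k"
proof (induction k)
  case (Suc k)
  have "(2 :: int) ^ (2 * Suc k + 2) + (-1) ^ Suc k
          = 5 * 2 ^ (2 * k + 2) - (2 ^ (2 * k + 2) + (-1) ^ k)"
    by simp
  with Suc show ?case by (metis dvd_diff dvd_triv_left)
qed simp

end

theory Submission
  imports Defs "HOL-Computational_Algebra.Formal_Power_Series"
begin

text \<open>The number \<open>B3 n\<close> is the twisted divisor sum of \<open>\<chi>(m) d\<^sup>2\<close> over all factorisations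
\<open>m d = n + 1\<close>, where \<open>\<chi>\<close> is the nontrivial character modulo 3
(\<open>B3_eq_chi_divisor_sum\<close>). The argument \<open>2\<^bsup>k+1\<^esup> n + 2\<^sup>k - 1\<close> is one less than
\<open>2\<^sup>k (2 n + 1)\<close>, and on \<open>2\<^sup>k m\<close> with \<open>m\<close> odd the divisor sum factors: the powers of two
contribute \<open>4\<^sup>k - 4\<^bsup>k-1\<^esup> + \<dots> \<plusminus> 1\<close>, which is exactly the modulus
(\<open>chi_divisor_sum_power_2_mult\<close>).

The formula for \<open>B3\<close> is obtained by showing that both sides satisfy one recurrence, with
kernel \<open>3 \<sigma>(j) - 27 \<sigma>(j / 3)\<close>.

For \<open>B3\<close>, the beta-set of a partition turns hook numbers into differences between elements and
non-elements (\<open>beta_eq_gap_plus_hook\<close>), so 3-cores are the finite sets closed under subtracting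
3. Such a set is given by its numbers of elements in the three residue classes
(\<open>card_three_cores\<close>). Splitting Euler's product over \<open>1 + z q\<^sup>i\<close> by residue classes
modulo 3 and comparing coefficients of \<open>z\<^sup>K\<close> for large \<open>K\<close> shows that 3-cores have the
generating function \<open>f\<^sub>3\<^sup>3 / f\<^sub>1\<close>, where \<open>f\<^sub>k\<close> is the product of all
\<open>1 - q\<^bsup>k i\<^esup>\<close> (\<open>theta_eq_eta_quotient\<close>). The logarithmic derivative of its cube
gives the recurrence (\<open>B3_recurrence\<close>).

For the divisor sum the recurrence is an identity between sums over the quadruples of positive
integers with \<open>a x + b y = N\<close>. It is an instance of a general identity in the style of Liouville,
which rests on two shears of this set (\<open>liouville_identity\<close>), applied to an explicit function
(\<open>chi_divisor_sum_recurrence\<close>).\<close>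

section \<open>Hook numbers and beta-sets\<close>

text \<open>Rows are extended by zero, so that a partition with at most \<open>K\<close> parts may be read as a
weakly decreasing sequence of length exactly \<open>K\<close>. All beta-sets below have a prescribed
size \<open>K\<close>; this lets partitions of different lengths be compared.\<close>

definition row :: "nat list \<Rightarrow> nat \<Rightarrow> nat" where
  "row xs i = (if i < length xs then xs ! i else 0)"

definition col :: "nat list \<Rightarrow> nat \<Rightarrow> nat" where
  "col xs j = card {i. j < row xs i}"

definition beta :: "nat \<Rightarrow> nat list \<Rightarrow> nat \<Rightarrow> nat" where
  "beta K xs i = row xs i + (K - 1 - i)"

definition beta_set :: "nat \<Rightarrow> nat list \<Rightarrow> nat set" where
  "beta_set K xs = beta K xs ` {..<K}"

lemma down_closed_eq_lessThan_card:
  fixes A :: "nat set"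
  assumes "finite A" "\<And>i j. j \<in> A \<Longrightarrow> i \<le> j \<Longrightarrow> i \<in> A"
  shows "A = {..<card A}"
proof (cases "A = {}")
  case False
  then have "A = {..Max A}"
    using assms(2)[OF Max_in[OF assms(1)]] Max_ge[OF assms(1)] by auto
  moreover from this have "card A = Suc (Max A)" by (metis card_atMost)
  ultimately show ?thesis by (metis lessThan_Suc_atMost)
qed simp

lemma row_antimono: "is_partition xs \<Longrightarrow> i \<le> i' \<Longrightarrow> row xs i' \<le> row xs i"
  by (cases "i = i'") (auto simp: row_def is_partition_def sorted_wrt_iff_nth_less)

lemma cells_iff: "(i, j) \<in> cells xs \<longleftrightarrow> j < row xs i"
  by (auto simp: cells_def row_def)

lemma finite_column: "finite {i. j < row xs i}"
  by (rule finite_subset[of _ "{..<length xs}"]) (auto simp: row_def split: if_splits)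

lemma less_col_iff: "is_partition xs \<Longrightarrow> i < col xs j \<longleftrightarrow> j < row xs i"
proof -
  assume "is_partition xs"
  then have "{i. j < row xs i} = {..<col xs j}" unfolding col_def
    by (intro down_closed_eq_lessThan_card finite_column) (auto dest: row_antimono order_less_le_trans)
  then show ?thesis by auto
qed

lemma col_le: "is_partition xs \<Longrightarrow> length xs \<le> K \<Longrightarrow> col xs j \<le> K"
  using less_col_iff[of xs K j] by (simp add: row_def not_less split: if_splits)

lemma hook_number_eq:
  assumes "is_partition xs" "(i, j) \<in> cells xs"
  shows "hook_number xs i j = (row xs i - 1 - j) + (col xs j - 1 - i) + 1"
proof -
  have "{j'. j < j' \<and> (i, j') \<in> cells xs} = {Suc j..<row xs i}"
    by (auto simp: cells_iff)
  moreover have "{i'. i < i' \<and> (i', j) \<in> cells xs} = {Suc i..<col xs j}"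
    by (auto simp: cells_iff less_col_iff[OF assms(1)])
  ultimately show ?thesis by (simp add: hook_number_def arm_length_def leg_length_def)
qed

lemma beta_strict_antimono:
  assumes "is_partition xs" "i < i'" "i' < K"
  shows "beta K xs i' < beta K xs i"
  using row_antimono[OF assms(1), of i i'] assms by (simp add: beta_def)

lemma inj_on_beta:
  assumes "is_partition xs"
  shows "inj_on (beta K xs) {..<K}"
proof (rule linorder_inj_onI)
  fix i i' assume "i < i'" "i \<in> {..<K}" "i' \<in> {..<K}"
  then show "beta K xs i \<noteq> beta K xs i'" using beta_strict_antimono[OF assms, of i i' K] by simp
qed (rule linear)

text \<open>The hook of a cell joins a bead of the beta-set to a gap below it: moving along row \<open>i\<close>,
the column index \<open>j\<close> runs through the gaps \<open>K + j - col xs j\<close> below the bead of that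
row, and the hook number is the distance between the two.\<close>

lemma beta_eq_gap_plus_hook:
  assumes "is_partition xs" "length xs \<le> K" "(i, j) \<in> cells xs"
  shows "beta K xs i = (K + j - col xs j) + hook_number xs i j"
proof -
  have "j < row xs i" "i < col xs j" using assms(3) less_col_iff[OF assms(1), of i j] by (simp_all add: cells_iff)
  moreover define a b d where "a = row xs i - Suc j" and "b = col xs j - Suc i" and "d = K - col xs j"
  ultimately have "row xs i = Suc j + a" "col xs j = Suc i + b" "K = col xs j + d"
    using col_le[OF assms(1,2), of j] by simp_all
  then show ?thesis unfolding hook_number_eq[OF assms(1,3)] beta_def by simp
qed

lemma gap_notin_beta_set:
  assumes "is_partition xs" "length xs \<le> K"
  shows "K + j - col xs j \<notin> beta_set K xs"
proof
  assume "K + j - col xs j \<in> beta_set K xs"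
  then obtain i where i: "i < K" "beta K xs i = K + j - col xs j" by (auto simp: beta_set_def)
  then show False using less_col_iff[OF assms(1), of i j] col_le[OF assms, of j]
    by (cases "j < row xs i") (auto simp: beta_def)
qed

text \<open>If \<open>c\<close> beads lie above the gap \<open>m\<close>, the path that bounds the Young diagram has passed
\<open>K - c\<close> beads before \<open>m\<close>, so \<open>m\<close> belongs to column \<open>m - (K - c)\<close>.\<close>

lemma gap_exhaust:
  assumes "is_partition xs" "length xs \<le> K" "i < K" "m < beta K xs i" "m \<notin> beta_set K xs"
  obtains j where "(i, j) \<in> cells xs" "m = K + j - col xs j"
proof -
  let ?A = "{i. i < K \<and> m < beta K xs i}"
  \<comment> \<open>The beads above \<open>m\<close> are those of the first \<open>c\<close> rows.\<close>
  define c where "c = card ?A"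
  have "i1 \<in> ?A" if "i2 \<in> ?A" "i1 \<le> i2" for i1 i2
    using that beta_strict_antimono[OF assms(1), of i1 i2 K] by (cases "i1 = i2") auto
  then have A: "?A = {..<c}" unfolding c_def by (intro down_closed_eq_lessThan_card) auto
  have "i < c" using A assms(3,4) by auto
  have "c \<le> K" using A by (metis (no_types, lifting) lessThan_iff lessThan_subset_iff mem_Collect_eq subsetI)
  have "c - 1 \<in> ?A" using A \<open>i < c\<close> by auto
  then have above: "m < row xs (c - 1) + (K - c)" "0 < c" using \<open>i < c\<close> by (auto simp: beta_def)
  have below: "row xs c + (K - c) \<le> m"
  proof (cases "c = K")
    case True
    then show ?thesis using assms(2) by (simp add: row_def)
  next
    case False
    then have "c < K" using \<open>c \<le> K\<close> by simp
    then have "\<not> m < beta K xs c" using A by blast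
    moreover have "m \<noteq> beta K xs c" using assms(5) \<open>c < K\<close> by (auto simp: beta_set_def)
    ultimately show ?thesis using \<open>c < K\<close> by (simp add: beta_def)
  qed
  \<comment> \<open>This subtraction does not truncate, by \<open>below\<close>.\<close>
  define j where "j = m + c - K"
  have j: "j < row xs (c - 1)" "row xs c \<le> j" "m = K + j - c"
    using above below \<open>c \<le> K\<close> by (auto simp: j_def)
  have "\<not> c < col xs j" "c - 1 < col xs j" using j less_col_iff[OF assms(1)] by auto
  then have "col xs j = c" using above by linarith
  moreover have "(i, j) \<in> cells xs"
    using \<open>i < c\<close> \<open>col xs j = c\<close> less_col_iff[OF assms(1), of i j] by (simp add: cells_iff)
  ultimately show thesis using j that by blast
qed

text \<open>A hook number divisible by \<open>t\<close> is a bead and a gap at distance \<open>t * s\<close>; somewhere on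
the way down from the bead in steps of \<open>t\<close> a bead is followed by a gap, which gives a hook
number equal to \<open>t\<close>.\<close>

lemma is_core_iff_beta_set:
  assumes "is_partition xs" "length xs \<le> K" "0 < t"
  shows "is_core t xs \<longleftrightarrow> (\<forall>m\<in>beta_set K xs. t \<le> m \<longrightarrow> m - t \<in> beta_set K xs)"
proof
  assume core: "is_core t xs"
  show "\<forall>m\<in>beta_set K xs. t \<le> m \<longrightarrow> m - t \<in> beta_set K xs"
  proof (intro ballI impI, rule ccontr)
    fix m assume m: "m \<in> beta_set K xs" "t \<le> m" "m - t \<notin> beta_set K xs"
    then obtain i where i: "i < K" "m = beta K xs i" by (auto simp: beta_set_def)
    obtain j where j: "(i, j) \<in> cells xs" "m - t = K + j - col xs j"
      using gap_exhaust[OF assms(1,2) i(1), of "m - t"] m i assms(3) by auto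
    then have "hook_number xs i j = t"
      using beta_eq_gap_plus_hook[OF assms(1,2) j(1)] i m by simp
    then show False using core j by (auto simp: is_core_def)
  qed
next
  assume closed: "\<forall>m\<in>beta_set K xs. t \<le> m \<longrightarrow> m - t \<in> beta_set K xs"
  have closed_mult: "m - t * s \<in> beta_set K xs" if "m \<in> beta_set K xs" "t * s \<le> m" for m s
    using that(2)
  proof (induction s)
    case (Suc s)
    then have "m - t * s \<in> beta_set K xs" "t \<le> m - t * s" by auto
    then have "m - t * s - t \<in> beta_set K xs" using closed by blast
    then show ?case by (simp add: algebra_simps)
  qed (use that in simp)
  have "\<not> t dvd hook_number xs i j" if c: "(i, j) \<in> cells xs" for i j
  proof
    assume "t dvd hook_number xs i j"
    then obtain s where s: "hook_number xs i j = t * s" by auto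
    have b: "beta K xs i = (K + j - col xs j) + t * s"
      using beta_eq_gap_plus_hook[OF assms(1,2) c] s by simp
    moreover have "beta K xs i \<in> beta_set K xs" using c assms(2)
      by (auto simp: cells_def beta_set_def)
    ultimately have "beta K xs i - t * s \<in> beta_set K xs"
      by (intro closed_mult) simp_all
    then show False using b gap_notin_beta_set[OF assms(1,2), of j] by simp
  qed
  then show "is_core t xs" using assms(1) by (auto simp: is_core_def)
qed

lemma sum_lessThan_eq_choose_two: "\<Sum>{..<n} = n choose 2"
  by (induction n) (auto simp: numeral_2_eq_2)

lemma sum_beta_set:
  assumes "is_partition xs" "length xs \<le> K"
  shows "\<Sum>(beta_set K xs) = sum_list xs + (K choose 2)"
proof -
  have "\<Sum>(beta_set K xs) = (\<Sum>i<K. row xs i) + (\<Sum>i<K. K - 1 - i)"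
    unfolding beta_set_def sum.reindex[OF inj_on_beta[OF assms(1)]]
    by (simp add: beta_def sum.distrib[symmetric])
  moreover have "(\<Sum>i<K. row xs i) = (\<Sum>i<length xs. row xs i)"
    by (rule sum.mono_neutral_right) (use assms(2) in \<open>auto simp: row_def\<close>)
  moreover have "\<dots> = sum_list xs"
    by (simp add: row_def sum_list_sum_nth atLeast0LessThan)
  moreover have "(\<Sum>i<K. K - 1 - i) = (\<Sum>i<K. i)"
    using sum.nat_diff_reindex[of "\<lambda>i. i" K] by simp
  ultimately show ?thesis using sum_lessThan_eq_choose_two[of K] by simp
qed

text \<open>A strictly decreasing enumeration is determined by its range: the index of an entry is the number
of larger entries. This is what makes the passage from partitions to beta-sets injective.\<close>

lemma card_above_strict_antimono:
  fixes f :: "nat \<Rightarrow> nat"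
  assumes "\<And>i i'. i < i' \<Longrightarrow> i' < K \<Longrightarrow> f i' < f i" "i < K"
  shows "card {m \<in> f ` {..<K}. f i < m} = i"
proof -
  have "f i < f i' \<longleftrightarrow> i' < i" if "i' < K" for i'
    using assms(1)[of i i'] assms(1)[of i' i] assms(2) that by (cases i i' rule: linorder_cases) auto
  then have "{m \<in> f ` {..<K}. f i < m} = f ` {..<i}" using assms(2) by auto
  moreover have "inj_on f {..<i}"
    using assms by (intro linorder_inj_onI) (auto, metis less_irrefl order_less_trans)
  ultimately show ?thesis by (simp add: card_image)
qed

lemma partition_eqI:
  assumes "is_partition xs" "is_partition ys" "\<And>i. row xs i = row ys i"
  shows "xs = ys"
proof -
  have pos: "{i. 0 < row zs i} = {..<length zs}" if "is_partition zs" for zs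
    using that by (auto simp: row_def is_partition_def in_set_conv_nth split: if_splits)
  have "length xs = length ys" using pos[OF assms(1)] pos[OF assms(2)] assms(3) by simp
  moreover have "zs ! i = row zs i" if "i < length zs" for zs i using that by (simp add: row_def)
  ultimately show ?thesis using assms(3) by (intro nth_equalityI) simp_all
qed

lemma inj_on_beta_set: "inj_on (beta_set K) {xs. is_partition xs \<and> length xs \<le> K}"
proof (rule inj_onI, clarify)
  fix xs ys assume x: "is_partition xs" "length xs \<le> K" and y: "is_partition ys" "length ys \<le> K"
    and eq: "beta_set K xs = beta_set K ys"
  have beta: "beta K xs i = beta K ys i" if i: "i < K" for i
  proof -
    have "beta K xs i \<in> beta_set K ys" using i eq by (auto simp: beta_set_def)
    then obtain i' where i': "i' < K" "beta K xs i = beta K ys i'" by (auto simp: beta_set_def)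
    have "i = card {m \<in> beta_set K xs. beta K xs i < m}"
      using card_above_strict_antimono[of K "beta K xs" i] beta_strict_antimono[OF x(1)] i
      by (simp add: beta_set_def)
    also have "\<dots> = i'"
      using card_above_strict_antimono[of K "beta K ys" i'] beta_strict_antimono[OF y(1)] i'
      unfolding eq i'(2) by (simp add: beta_set_def)
    finally show ?thesis using i' by simp
  qed
  have "row xs i = row ys i" for i
  proof (cases "i < K")
    case True
    then show ?thesis using beta[OF True] by (simp add: beta_def)
  qed (use x y in \<open>simp add: row_def\<close>)
  then show "xs = ys" using x y by (intro partition_eqI)
qed

lemma ex_partition_row:
  fixes \<mu> :: "nat \<Rightarrow> nat"
  assumes "\<And>i i'. i \<le> i' \<Longrightarrow> \<mu> i' \<le> \<mu> i" "\<And>i. K \<le> i \<Longrightarrow> \<mu> i = 0"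
  shows "\<exists>xs. is_partition xs \<and> length xs \<le> K \<and> row xs = \<mu>"
proof -
  define l where "l = card {i. 0 < \<mu> i}"
  have fin: "finite {i. 0 < \<mu> i}"
    by (rule finite_subset[of _ "{..<K}"]) (auto, metis assms(2) less_irrefl not_le)
  have l: "{i. 0 < \<mu> i} = {..<l}" unfolding l_def
    by (intro down_closed_eq_lessThan_card fin) (auto dest: assms(1) order_less_le_trans)
  have pos_iff: "0 < \<mu> i \<longleftrightarrow> i < l" for i
  proof -
    have "i \<in> {i. 0 < \<mu> i} \<longleftrightarrow> i \<in> {..<l}" unfolding l ..
    then show ?thesis by simp
  qed
  let ?xs = "map \<mu> [0..<l]"
  have "0 \<notin> \<mu> ` {..<l}" unfolding l[symmetric] by auto
  then have "is_partition ?xs"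
    using assms(1) by (simp add: is_partition_def sorted_wrt_iff_nth_less atLeast0LessThan)
  moreover have "l \<le> K" using pos_iff[of K] assms(2)[of K] by simp
  moreover have "row ?xs i = \<mu> i" for i using pos_iff[of i] by (cases "i < l") (simp_all add: row_def)
  ultimately show ?thesis by (intro exI[of _ ?xs]) auto
qed

lemma ex_partition_beta_set:
  assumes "finite A" "card A = K"
  shows "\<exists>xs. is_partition xs \<and> length xs \<le> K \<and> beta_set K xs = A"
proof -
  define f where "f i = rev (sorted_list_of_set A) ! i" for i
  let ?l = "rev (sorted_list_of_set A)"
  have len: "length ?l = K" using assms by simp
  have "sorted_wrt (>) ?l" by (simp add: sorted_wrt_rev)
  then have f: "f i' < f i" if "i < i'" "i' < K" for i i'
    using that len by (simp add: f_def sorted_wrt_iff_nth_less)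
  have A: "A = f ` {..<K}"
  proof -
    have "A = set ?l" using assms by simp
    also have "\<dots> = f ` {..<K}" unfolding set_conv_nth len f_def by auto
    finally show ?thesis .
  qed
  have step: "f (i + d) + d \<le> f i" if "i + d < K" for i d
    using that
  proof (induction d)
    case (Suc d)
    then have "f (i + Suc d) < f (i + d)" by (intro f) auto
    with Suc show ?case by simp
  qed simp
  define \<mu> where "\<mu> i = (if i < K then f i - (K - 1 - i) else 0)" for i
  have "\<mu> i' \<le> \<mu> i" if "i \<le> i'" for i i'
    using step[of i "i' - i"] that by (auto simp: \<mu>_def)
  moreover have "\<mu> i = 0" if "K \<le> i" for i using that by (simp add: \<mu>_def)
  ultimately obtain xs where xs: "is_partition xs" "length xs \<le> K" "row xs = \<mu>"
    using ex_partition_row[of \<mu> K] by blast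
  have "beta K xs i = f i" if "i < K" for i
    using step[of i "K - 1 - i"] that by (simp add: beta_def xs \<mu>_def)
  then have "beta_set K xs = A" by (simp add: beta_set_def A)
  then show ?thesis using xs by blast
qed

section \<open>3-cores on the three-runner abacus\<close>

definition abacus :: "nat \<times> nat \<times> nat \<Rightarrow> nat set" where
  "abacus = (\<lambda>(k0, k1, k2). (\<lambda>i. 3 * i) ` {..<k0} \<union> (\<lambda>i. 3 * i + 1) ` {..<k1} \<union> (\<lambda>i. 3 * i + 2) ` {..<k2})"

definition abacus_weight :: "nat \<times> nat \<times> nat \<Rightarrow> nat" where
  "abacus_weight = (\<lambda>(k0, k1, k2). 3 * (k0 choose 2) + (3 * (k1 choose 2) + k1) + (3 * (k2 choose 2) + 2 * k2))"

lemma abacus_mem: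
  "3 * i \<in> abacus (k0, k1, k2) \<longleftrightarrow> i < k0"
  "3 * i + 1 \<in> abacus (k0, k1, k2) \<longleftrightarrow> i < k1"
  "3 * i + 2 \<in> abacus (k0, k1, k2) \<longleftrightarrow> i < k2"
  unfolding abacus_def image_iff by (auto simp: image_iff) presburger+

lemma sum_abacus:
  fixes f :: "nat \<Rightarrow> nat"
  shows "sum f (abacus (k0, k1, k2)) = (\<Sum>i<k0. f (3 * i)) + (\<Sum>i<k1. f (3 * i + 1)) + (\<Sum>i<k2. f (3 * i + 2))"
proof -
  have "sum f (abacus (k0, k1, k2)) = sum f ((\<lambda>i. 3 * i) ` {..<k0} \<union> (\<lambda>i. 3 * i + 1) ` {..<k1})
      + sum f ((\<lambda>i. 3 * i + 2) ` {..<k2})"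
    unfolding abacus_def prod.case by (rule sum.union_disjoint) (auto, presburger+)
  also have "sum f ((\<lambda>i. 3 * i) ` {..<k0} \<union> (\<lambda>i. 3 * i + 1) ` {..<k1})
      = sum f ((\<lambda>i. 3 * i) ` {..<k0}) + sum f ((\<lambda>i. 3 * i + 1) ` {..<k1})"
    by (rule sum.union_disjoint) (auto, presburger)
  finally show ?thesis by (simp add: sum.reindex inj_on_def)
qed

lemma card_abacus: "card (abacus (k0, k1, k2)) = k0 + k1 + k2"
  using sum_abacus[of "\<lambda>_. 1" k0 k1 k2] by simp

lemma finite_abacus [simp]: "finite (abacus k)"
  by (simp add: abacus_def case_prod_unfold)

lemma Sum_abacus: "\<Sum>(abacus k) = abacus_weight k"
proof -
  obtain k0 k1 k2 where k: "k = (k0, k1, k2)" by (cases k)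
  have "(\<Sum>i<n. 3 * i + r) = 3 * (n choose 2) + r * n" for n r :: nat
    by (simp add: sum.distrib sum_distrib_left[symmetric] sum_lessThan_eq_choose_two)
  from this[where r = 0] this[where r = 1] this[where r = 2] show ?thesis
    unfolding k sum_abacus abacus_weight_def by simp
qed

lemma inj_abacus: "inj abacus"
proof (rule injI)
  fix k l :: "nat \<times> nat \<times> nat" assume eq: "abacus k = abacus l"
  obtain k0 k1 k2 where k: "k = (k0, k1, k2)" by (cases k)
  obtain l0 l1 l2 where l: "l = (l0, l1, l2)" by (cases l)
  have "i < k0 \<longleftrightarrow> i < l0" "i < k1 \<longleftrightarrow> i < l1" "i < k2 \<longleftrightarrow> i < l2" for i
    using eq abacus_mem[of i k0 k1 k2] abacus_mem[of i l0 l1 l2] by (simp_all only: k l)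
  then show "k = l" unfolding k l by (metis linorder_neq_iff prod.inject)
qed

lemma abacus_closed: "m \<in> abacus k \<Longrightarrow> 3 \<le> m \<Longrightarrow> m - 3 \<in> abacus k"
proof -
  assume m: "m \<in> abacus k" "3 \<le> m"
  obtain k0 k1 k2 where k: "k = (k0, k1, k2)" by (cases k)
  have "\<exists>i. m = 3 * Suc i \<or> m = 3 * Suc i + 1 \<or> m = 3 * Suc i + 2"
    using m(2) by presburger
  then obtain i where "m = 3 * Suc i \<or> m = 3 * Suc i + 1 \<or> m = 3 * Suc i + 2" ..
  then show ?thesis
  proof (elim disjE)
    assume "m = 3 * Suc i"
    then show ?thesis using m(1) abacus_mem(1)[of i k0 k1 k2] abacus_mem(1)[of "Suc i" k0 k1 k2]
      by (simp add: k)
  next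
    assume "m = 3 * Suc i + 1"
    then show ?thesis using m(1) abacus_mem(2)[of i k0 k1 k2] abacus_mem(2)[of "Suc i" k0 k1 k2]
      by (simp add: k)
  next
    assume "m = 3 * Suc i + 2"
    then show ?thesis using m(1) abacus_mem(3)[of i k0 k1 k2] abacus_mem(3)[of "Suc i" k0 k1 k2]
      by (simp add: k)
  qed
qed

text \<open>A finite set closed under subtracting 3 is, on each residue class, an initial segment.\<close>

lemma ex_abacus_of_closed:
  assumes "finite A" "\<And>m. m \<in> A \<Longrightarrow> 3 \<le> m \<Longrightarrow> m - 3 \<in> A"
  shows "\<exists>k. A = abacus k"
proof -
  have runner: "\<exists>n. \<forall>i. 3 * i + r \<in> A \<longleftrightarrow> i < n" for r
  proof -
    have "3 * i + r \<in> A" if "3 * (i + d) + r \<in> A" for i d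
      using that
    proof (induction d)
      case (Suc d)
      then have "3 * (i + Suc d) + r - 3 \<in> A" by (intro assms(2)) auto
      then show ?case by (intro Suc.IH) (simp add: algebra_simps)
    qed simp
    then have "3 * i + r \<in> A" if "3 * j + r \<in> A" "i \<le> j" for i j
      using that by (metis le_add_diff_inverse)
    moreover have "finite {i. 3 * i + r \<in> A}"
      using finite_vimageI[OF assms(1), of "\<lambda>i. 3 * i + r"] by (simp add: inj_def vimage_def)
    ultimately have "{i. 3 * i + r \<in> A} = {..<card {i. 3 * i + r \<in> A}}"
      by (intro down_closed_eq_lessThan_card) auto
    then show ?thesis by blast
  qed
  obtain k0 where k0: "\<And>i. 3 * i \<in> A \<longleftrightarrow> i < k0" using runner[of 0] by auto
  obtain k1 where k1: "\<And>i. 3 * i + 1 \<in> A \<longleftrightarrow> i < k1" using runner[of 1] by blast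
  obtain k2 where k2: "\<And>i. 3 * i + 2 \<in> A \<longleftrightarrow> i < k2" using runner[of 2] by blast
  have "m \<in> A \<longleftrightarrow> m \<in> abacus (k0, k1, k2)" for m
  proof -
    define i where "i = m div 3"
    have "m = 3 * i \<or> m = 3 * i + 1 \<or> m = 3 * i + 2" unfolding i_def by presburger
    then consider "m = 3 * i" | "m = 3 * i + 1" | "m = 3 * i + 2" by blast
    then show ?thesis
      by cases (simp_all only: k0 k1 k2 abacus_mem)
  qed
  then show ?thesis by blast
qed

text \<open>Every \<open>K \<ge> n\<close> may serve as the number of beads, since a partition of \<open>n\<close> has at most
\<open>n\<close> parts. The freedom in \<open>K\<close> is what permits the limit argument for the generating
function.\<close>

lemma card_three_cores:
  assumes "n \<le> K"
  shows "card {xs. is_core 3 xs \<and> sum_list xs = n} =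
    card {(k0, k1, k2). k0 + k1 + k2 = K \<and> abacus_weight (k0, k1, k2) = (K choose 2) + n}"
proof -
  let ?A = "{A. finite A \<and> card A = K \<and> (\<forall>m\<in>A. 3 \<le> m \<longrightarrow> m - 3 \<in> A) \<and> \<Sum>A = (K choose 2) + n}"
  have short: "length xs \<le> K" if "is_core 3 xs" "sum_list xs = n" for xs
    using that assms length_le_sum_list[of xs] by (auto simp: is_core_def is_partition_def)
  have part: "is_partition xs" if "is_core 3 xs" for xs using that by (simp add: is_core_def)
  have "bij_betw (beta_set K) {xs. is_core 3 xs \<and> sum_list xs = n} ?A"
  proof (rule bij_betw_imageI)
    show "inj_on (beta_set K) {xs. is_core 3 xs \<and> sum_list xs = n}"
      by (rule inj_on_subset[OF inj_on_beta_set[of K]]) (use short part in auto)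
    show "beta_set K ` {xs. is_core 3 xs \<and> sum_list xs = n} = ?A"
    proof (intro equalityI subsetI)
      fix A assume "A \<in> beta_set K ` {xs. is_core 3 xs \<and> sum_list xs = n}"
      then obtain xs where xs: "A = beta_set K xs" "is_core 3 xs" "sum_list xs = n" by auto
      then have p: "is_partition xs" "length xs \<le> K" using short part by auto
      then have "card A = K" unfolding xs(1) beta_set_def
        by (simp add: card_image inj_on_beta)
      moreover have "finite A" by (simp add: xs(1) beta_set_def)
      moreover have "\<forall>m\<in>A. 3 \<le> m \<longrightarrow> m - 3 \<in> A"
        using is_core_iff_beta_set[OF p, of 3] xs by simp
      moreover have "\<Sum>A = (K choose 2) + n" using sum_beta_set[OF p] xs by simp
      ultimately show "A \<in> ?A" by blast
    next
      fix A assume A: "A \<in> ?A"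
      then obtain xs where xs: "is_partition xs" "length xs \<le> K" "beta_set K xs = A"
        using ex_partition_beta_set by blast
      have "is_core 3 xs" using is_core_iff_beta_set[OF xs(1,2), of 3, unfolded xs(3)] A by simp
      moreover have "sum_list xs = n" using sum_beta_set[OF xs(1,2)] A xs(3) by simp
      ultimately show "A \<in> beta_set K ` {xs. is_core 3 xs \<and> sum_list xs = n}"
        using xs(3) by blast
    qed
  qed
  then have "card {xs. is_core 3 xs \<and> sum_list xs = n} = card ?A" by (rule bij_betw_same_card)
  also have "\<dots> = card {(k0, k1, k2). k0 + k1 + k2 = K \<and> abacus_weight (k0, k1, k2) = (K choose 2) + n}"
  proof (rule bij_betw_same_card[symmetric], rule bij_betw_imageI)
    let ?k = "{(k0, k1, k2). k0 + k1 + k2 = K \<and> abacus_weight (k0, k1, k2) = (K choose 2) + n}"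
    show "inj_on abacus ?k" by (rule inj_on_subset[OF inj_abacus]) simp
    show "abacus ` ?k = ?A"
    proof (intro equalityI subsetI)
      fix A assume "A \<in> abacus ` ?k"
      then show "A \<in> ?A" using card_abacus by (auto simp: Sum_abacus abacus_closed)
    next
      fix A assume A: "A \<in> ?A"
      then obtain k0 k1 k2 where "A = abacus (k0, k1, k2)" using ex_abacus_of_closed[of A] by auto
      then show "A \<in> abacus ` ?k" using A card_abacus[of k0 k1 k2] Sum_abacus[of "(k0, k1, k2)"] by auto
    qed
  qed
  finally show ?thesis .
qed

section \<open>The generating function of 3-cores\<close>

unbundle fps_syntax

lemma fps_mult3_nth:
  fixes A B C :: "'a::comm_semiring_0 fps"
  shows "(A * B * C) $ n = (\<Sum>(i, j, k)\<in>{(i, j, k). i + j + k = n}. A $ i * B $ j * C $ k)"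
proof -
  have "(A * B * C) $ n = (\<Sum>m\<in>{0..n}. \<Sum>i\<in>{0..m}. A $ i * B $ (m - i) * C $ (n - m))"
    by (simp add: fps_mult_nth sum_distrib_right)
  also have "\<dots> = (\<Sum>(m, i)\<in>(SIGMA m:{0..n}. {0..m}). A $ i * B $ (m - i) * C $ (n - m))"
    by (subst sum.Sigma) auto
  also have "\<dots> = (\<Sum>(i, j, k)\<in>{(i, j, k). i + j + k = n}. A $ i * B $ j * C $ k)"
    by (rule sum.reindex_bij_witness[where i = "\<lambda>(i, j, k). (i + j, i)"
        and j = "\<lambda>(m, i). (i, m - i, n - m)"]) auto
  finally show ?thesis .
qed

definition qpoch :: "nat \<Rightarrow> nat \<Rightarrow> rat fps" where
  "qpoch k n = (\<Prod>i\<in>{1..n}. 1 - fps_X ^ (k * i))"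

lemma one_minus_X_power_nth_0 [simp]: "0 < m \<Longrightarrow> (1 - fps_X ^ m :: rat fps) $ 0 = 1"
  by simp

lemma one_minus_X_power_nz [simp]: "0 < m \<Longrightarrow> (1 - fps_X ^ m :: rat fps) \<noteq> 0"
  using one_minus_X_power_nth_0[of m] by (metis fps_zero_nth zero_neq_one)

lemma qpoch_nth_0 [simp]: "0 < k \<Longrightarrow> qpoch k n $ 0 = 1"
  unfolding qpoch_def by (induction n) auto

lemma qpoch_Suc: "qpoch k (Suc n) = qpoch k n * (1 - fps_X ^ (k * Suc n))"
  unfolding qpoch_def by (simp add: prod.atLeastLessThan_Suc atLeastLessThanSuc_atLeastAtMost)

lemma inverse_qpoch_mult: "0 < k \<Longrightarrow> inverse (qpoch k n) * qpoch k n = 1"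
  by (rule inverse_mult_eq_1) simp

text \<open>This is Euler's generating function of the \<open>n\<close>-element subsets of the natural numbers by
the sum of their elements, with \<open>q\<close> replaced by \<open>q\<^sup>k\<close>.\<close>

definition subsets_gf :: "nat \<Rightarrow> nat \<Rightarrow> rat fps" where
  "subsets_gf k n = fps_X ^ (k * (n choose 2)) * inverse (qpoch k n)"

lemma subsets_gf_0 [simp]: "subsets_gf k 0 = 1"
  by (simp add: subsets_gf_def qpoch_def binomial_eq_0)

lemma subsets_gf_Suc:
  assumes "0 < k"
  shows "subsets_gf k (Suc n) * (1 - fps_X ^ (k * Suc n)) = fps_X ^ (k * n) * subsets_gf k n"
proof -
  have "inverse (qpoch k (Suc n)) = inverse (qpoch k n) * inverse (1 - fps_X ^ (k * Suc n))"
    by (simp add: qpoch_Suc fps_inverse_mult)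
  moreover have "inverse (1 - fps_X ^ (k * Suc n)) * (1 - fps_X ^ (k * Suc n)) = (1 :: rat fps)"
    by (rule inverse_mult_eq_1) (use assms in simp)
  moreover have "Suc n choose 2 = n + (n choose 2)" by (simp add: numeral_2_eq_2)
  ultimately show ?thesis
    by (simp add: subsets_gf_def power_add distrib_left mult_ac)
qed

text \<open>The outer variable \<open>z\<close> of this series with power series coefficients marks the size of the
subset, so the series is the product of all \<open>1 + z q\<^bsup>k i\<^esup>\<close>, and \<open>scale c\<close>
substitutes \<open>c z\<close> for \<open>z\<close>. The functional equation replaces the infinite product.\<close>

definition euler_series :: "nat \<Rightarrow> rat fps fps" where
  "euler_series k = Abs_fps (subsets_gf k)"

definition scale :: "'a::comm_semiring_1 \<Rightarrow> 'a fps \<Rightarrow> 'a fps" where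
  "scale c F = Abs_fps (\<lambda>n. c ^ n * F $ n)"

lemma scale_mult: "scale c (F * G) = scale c F * scale c G"
proof (rule fps_ext)
  fix n
  have "c ^ n * (F $ i * G $ (n - i)) = c ^ i * F $ i * (c ^ (n - i) * G $ (n - i))" if "i \<le> n" for i
  proof -
    have "c ^ n = c ^ i * c ^ (n - i)" using that by (simp add: power_add[symmetric])
    then show ?thesis by (simp only: mult_ac)
  qed
  then show "scale c (F * G) $ n = (scale c F * scale c G) $ n"
    by (simp add: scale_def fps_mult_nth sum_distrib_left)
qed

lemma scale_scale: "scale c (scale d F) = scale (c * d) F"
  by (simp add: scale_def power_mult_distrib mult_ac)

lemma one_plus_X_mult_nth_Suc:
  "((1 + fps_X) * F) $ Suc n = F $ Suc n + (F $ n :: 'a :: comm_semiring_1)"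
  by (simp add: distrib_right)

lemma euler_series_functional_eq:
  assumes "0 < k"
  shows "euler_series k = (1 + fps_X) * scale (fps_X ^ k) (euler_series k)"
proof (rule fps_ext)
  fix n
  show "euler_series k $ n = ((1 + fps_X) * scale (fps_X ^ k) (euler_series k)) $ n"
  proof (cases n)
    case 0
    then show ?thesis by (simp add: euler_series_def scale_def)
  next
    case (Suc m)
    have "subsets_gf k (Suc m) = fps_X ^ (k * Suc m) * subsets_gf k (Suc m) + fps_X ^ (k * m) * subsets_gf k m"
      using subsets_gf_Suc[OF assms, of m] by (simp add: algebra_simps)
    then show ?thesis unfolding Suc one_plus_X_mult_nth_Suc
      by (simp only: euler_series_def scale_def power_mult fps_nth_Abs_fps)
  qed
qed

text \<open>A set of natural numbers is a triple of sets, one for each residue class modulo 3. The product on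
the right satisfies the functional equation of the left side, because substituting \<open>q z\<close>
permutes its three factors up to the factor \<open>1 + z\<close>; the functional equation determines all
coefficients from the constant one.\<close>

lemma euler_series_split_mod_3:
  "euler_series 1 =
    euler_series 3 * scale fps_X (euler_series 3) * scale (fps_X ^ 2) (euler_series 3)" (is "_ = ?G")
proof -
  let ?Z = "euler_series 3"
  have "scale fps_X ?G = scale fps_X ?Z * scale (fps_X ^ 2) ?Z * scale (fps_X ^ 3) ?Z"
    by (simp add: scale_mult scale_scale power2_eq_square power3_eq_cube mult.assoc)
  moreover have "?Z * A * B = (1 + fps_X) * (A * B * scale (fps_X ^ 3) ?Z)" for A B
  proof -
    have "Z * A * B = (1 + fps_X) * (A * B * C)" if "Z = (1 + fps_X) * C" for Z C :: "rat fps fps"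
      unfolding that by (simp only: mult_ac)
    from this[OF euler_series_functional_eq] show ?thesis by simp
  qed
  ultimately have G: "?G = (1 + fps_X) * scale fps_X ?G" by (simp only:)
  have "?G $ n = subsets_gf 1 n" for n
  proof (induction n)
    case 0
    then show ?case by (simp add: euler_series_def scale_def)
  next
    case (Suc n)
    have "?G $ Suc n = fps_X ^ Suc n * ?G $ Suc n + fps_X ^ n * ?G $ n"
      using arg_cong[OF G, of "\<lambda>F. F $ Suc n"] unfolding one_plus_X_mult_nth_Suc
      by (simp only: scale_def fps_nth_Abs_fps)
    then have "?G $ Suc n * (1 - fps_X ^ Suc n) = fps_X ^ n * subsets_gf 1 n"
      unfolding Suc.IH[symmetric] by (simp add: algebra_simps)
    also have "\<dots> = subsets_gf 1 (Suc n) * (1 - fps_X ^ Suc n)"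
      using subsets_gf_Suc[of 1 n] by simp
    finally show ?case
      by (simp only: mult_right_cancel[OF one_minus_X_power_nz[OF zero_less_Suc]])
  qed
  moreover have "euler_series 1 $ n = subsets_gf 1 n" for n
    by (simp add: euler_series_def)
  ultimately show ?thesis by (intro fps_ext) (simp only:)
qed

lemma finite_triples [simp]: "finite {(i, j, k). i + j + k = (n::nat)}"
  by (rule finite_subset[of _ "{..n} \<times> {..n} \<times> {..n}"]) auto

text \<open>The coefficient of \<open>z\<^sup>K\<close> in the splitting modulo 3. In combinatorial terms: a partition
is its 3-core, encoded by \<open>(k0, k1, k2)\<close>, together with its 3-quotient.\<close>

lemma inverse_qpoch_split:
  "fps_X ^ (K choose 2) * inverse (qpoch 1 K) =
    (\<Sum>(k0, k1, k2)\<in>{(i, j, k). i + j + k = K}.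
        fps_X ^ abacus_weight (k0, k1, k2) * (inverse (qpoch 3 k0) * inverse (qpoch 3 k1) * inverse (qpoch 3 k2)))"
proof -
  have "subsets_gf 1 K = (euler_series 3 * scale fps_X (euler_series 3) * scale (fps_X ^ 2) (euler_series 3)) $ K"
    unfolding euler_series_split_mod_3[symmetric] by (simp add: euler_series_def)
  then show ?thesis
    unfolding fps_mult3_nth
    by (simp add: subsets_gf_def euler_series_def scale_def abacus_weight_def power_add
         power_mult[symmetric] mult_ac case_prod_unfold)
qed

lemma mult_one_minus_X_power_prod_nth:
  fixes F :: "'a :: comm_ring_1 fps"
  assumes "\<And>i. i \<in> I \<Longrightarrow> n < m i" "j \<le> n"
  shows "(F * (\<Prod>i\<in>I. 1 - fps_X ^ m i)) $ j = F $ j"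
  using assms
proof (induction I rule: infinite_finite_induct)
  case (insert i I)
  let ?P = "\<Prod>i\<in>I. 1 - fps_X ^ m i"
  have "(F * (\<Prod>i\<in>insert i I. 1 - fps_X ^ m i)) $ j = (F * ?P - fps_X ^ m i * (F * ?P)) $ j"
    using insert by (simp add: algebra_simps)
  also have "\<dots> = (F * ?P) $ j" using insert.prems(1)[of i] insert.prems(2)
    by (simp add: fps_X_power_mult_nth)
  finally show ?case using insert by simp
qed auto

lemma qpoch_ratio:
  assumes "0 < k" "m \<le> n"
  shows "inverse (qpoch k m) * qpoch k n = (\<Prod>i\<in>{m<..n}. 1 - fps_X ^ (k * i))"
proof -
  have "{1..n} = {1..m} \<union> {m<..n}" using assms by auto
  then have "qpoch k n = qpoch k m * (\<Prod>i\<in>{m<..n}. 1 - fps_X ^ (k * i))"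
    unfolding qpoch_def by (simp add: prod.union_disjoint ivl_disj_int)
  then show ?thesis using inverse_qpoch_mult[OF assms(1), of m] by (simp add: mult.assoc[symmetric])
qed

lemma two_choose: "2 * int (k choose 2) = int k * (int k - 1)"
  by (induction k) (auto simp: numeral_2_eq_2 algebra_simps)

text \<open>With \<open>k0 = M + a\<close>, \<open>k1 = M + b\<close>, \<open>k2 = M + c\<close> twice the excess weight is
\<open>3 a\<^sup>2 - 2 a + 3 b\<^sup>2 + 3 c\<^sup>2 + 2 c\<close>, which is at least
\<open>a\<^sup>2 + b\<^sup>2 + c\<^sup>2\<close>. Triples of small excess weight therefore have all three entries
close to \<open>M\<close>.\<close>

lemma abacus_weight_bounds:
  assumes K: "k0 + k1 + k2 = 3 * M"
  shows "3 * M choose 2 \<le> abacus_weight (k0, k1, k2)"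
    and "abacus_weight (k0, k1, k2) \<le> (3 * M choose 2) + n \<Longrightarrow> 3 * n \<le> M \<Longrightarrow> n \<le> k0 \<and> n \<le> k1 \<and> n \<le> k2"
proof -
  define a b c where "a = int k0 - int M" and "b = int k1 - int M" and "c = int k2 - int M"
  have abc: "a + b + c = 0" using K by (simp add: a_def b_def c_def)
  have k: "int k0 = a + int M" "int k1 = b + int M" "int k2 = c + int M"
    by (simp_all add: a_def b_def c_def)
  have "2 * int (abacus_weight (k0, k1, k2)) - 2 * int (3 * M choose 2) =
     3 * (2 * int (k0 choose 2)) + 3 * (2 * int (k1 choose 2)) + 2 * int k1
     + 3 * (2 * int (k2 choose 2)) + 4 * int k2 - 2 * int (3 * M choose 2)"
    unfolding abacus_weight_def by simp
  also have "\<dots> = 3 * (int k0 * (int k0 - 1)) + 3 * (int k1 * (int k1 - 1)) + 2 * int k1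
     + 3 * (int k2 * (int k2 - 1)) + 4 * int k2 - 3 * int M * (3 * int M - 1)"
    unfolding two_choose by simp
  also have "\<dots> = 3 * a\<^sup>2 - 2 * a + 3 * b\<^sup>2 + 3 * c\<^sup>2 + 2 * c"
    unfolding k using abc by algebra
  \<comment> \<open>The linear terms \<open>2 b + 4 c\<close> have become \<open>2 c - 2 a\<close> by means of \<open>a + b + c = 0\<close>, which lets each variable be bounded on its own.\<close>
  finally have E: "2 * int (abacus_weight (k0, k1, k2)) - 2 * int (3 * M choose 2)
      = 3 * a\<^sup>2 - 2 * a + 3 * b\<^sup>2 + 3 * c\<^sup>2 + 2 * c" .
  have sq: "\<bar>z\<bar> \<le> z\<^sup>2" for z :: int
    using mult_mono[of 1 "\<bar>z\<bar>" "\<bar>z\<bar>" "\<bar>z\<bar>"] by (cases "z = 0") (simp_all add: power2_eq_square)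
  show "3 * M choose 2 \<le> abacus_weight (k0, k1, k2)"
    using E sq[of a] sq[of b] sq[of c] by linarith
  assume "abacus_weight (k0, k1, k2) \<le> (3 * M choose 2) + n" "3 * n \<le> M"
  then show "n \<le> k0 \<and> n \<le> k1 \<and> n \<le> k2"
    using E sq[of a] sq[of b] sq[of c] k by linarith
qed

text \<open>Letting \<open>M\<close> grow in the splitting turns \<open>1 / qpoch 3 k\<close> into
\<open>1 / qpoch 3 K\<close> up to terms of order above \<open>n\<close>, for all triples that contribute.
Therefore the numbers of 3-cores are the coefficients of \<open>f\<^sub>3\<^sup>3 / f\<^sub>1\<close>. Working
with the truncated products \<open>qpoch\<close> keeps every identity finite.\<close>

lemma theta_eq_eta_quotient:
  assumes "3 * n \<le> M" "j \<le> n"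
  shows "(qpoch 3 (3 * M) ^ 3 * inverse (qpoch 1 (3 * M))) $ j =
    of_nat (card {(k0, k1, k2). k0 + k1 + k2 = 3 * M \<and> abacus_weight (k0, k1, k2) = (3 * M choose 2) + j})"
proof -
  let ?K = "3 * M" and ?Q = "qpoch 3 (3 * M)"
  let ?S = "{(i, j, k). i + j + k = ?K}"
  have "fps_X ^ (?K choose 2) * (?Q ^ 3 * inverse (qpoch 1 ?K)) = ?Q ^ 3 * (fps_X ^ (?K choose 2) * inverse (qpoch 1 ?K))"
    by (simp add: mult_ac)
  also have "\<dots> = (\<Sum>(k0, k1, k2)\<in>?S. fps_X ^ abacus_weight (k0, k1, k2) *
      ((inverse (qpoch 3 k0) * ?Q) * (inverse (qpoch 3 k1) * ?Q) * (inverse (qpoch 3 k2) * ?Q)))"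
    unfolding inverse_qpoch_split
    by (simp add: sum_distrib_left case_prod_unfold power3_eq_cube mult_ac)
  finally have "(?Q ^ 3 * inverse (qpoch 1 ?K)) $ j = (\<Sum>(k0, k1, k2)\<in>?S. fps_X ^ abacus_weight (k0, k1, k2) *
      ((inverse (qpoch 3 k0) * ?Q) * (inverse (qpoch 3 k1) * ?Q) * (inverse (qpoch 3 k2) * ?Q))) $ ((?K choose 2) + j)"
    using fps_X_power_mult_nth[of "?K choose 2" "?Q ^ 3 * inverse (qpoch 1 ?K)" "(?K choose 2) + j"] by simp
  also have "\<dots> = (\<Sum>k\<in>?S. if abacus_weight k = (?K choose 2) + j then 1 else 0)"
  proof (unfold fps_sum_nth, intro sum.cong refl, clarify)
    fix k0 k1 k2 assume K: "k0 + k1 + k2 = ?K"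
    let ?H = "(inverse (qpoch 3 k0) * ?Q) * (inverse (qpoch 3 k1) * ?Q) * (inverse (qpoch 3 k2) * ?Q)"
    let ?w = "abacus_weight (k0, k1, k2)"
    have "?H $ i = (if i = 0 then 1 else 0)" if "n \<le> k0 \<and> n \<le> k1 \<and> n \<le> k2" "i \<le> n" for i
    proof -
      have H: "?H = 1 * (\<Prod>i\<in>{k0<..?K}. 1 - fps_X ^ (3 * i)) * (\<Prod>i\<in>{k1<..?K}. 1 - fps_X ^ (3 * i))
         * (\<Prod>i\<in>{k2<..?K}. 1 - fps_X ^ (3 * i))"
        using K by (simp add: qpoch_ratio)
      show ?thesis unfolding H using that
        by (subst mult_one_minus_X_power_prod_nth[where n = n], force, force)+ simp
    qed
    moreover have "n \<le> k0 \<and> n \<le> k1 \<and> n \<le> k2" if "?w \<le> (?K choose 2) + j"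
      using that assms by (intro abacus_weight_bounds(2)[OF K]) auto
    moreover have "(?K choose 2) + j - ?w \<le> n" using abacus_weight_bounds(1)[OF K] assms by simp
    ultimately show "(fps_X ^ ?w * ?H) $ ((?K choose 2) + j) = (if ?w = (?K choose 2) + j then 1 else 0)"
      using abacus_weight_bounds(1)[OF K]
      by (auto simp: fps_X_power_mult_nth not_less)
  qed
  also have "\<dots> = of_nat (card {k \<in> ?S. abacus_weight k = (?K choose 2) + j})"
    by (subst sum.If_cases) (auto simp: Int_def)
  also have "{k \<in> ?S. abacus_weight k = (?K choose 2) + j} =
     {(k0, k1, k2). k0 + k1 + k2 = ?K \<and> abacus_weight (k0, k1, k2) = (?K choose 2) + j}" by auto
  finally show ?thesis .
qed

section \<open>Logarithmic derivatives of power series\<close>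

definition log_deriv :: "rat fps \<Rightarrow> rat fps" where
  "log_deriv F = fps_X * fps_deriv F * inverse F"

lemma log_deriv_mult:
  assumes "F $ 0 \<noteq> 0" "G $ 0 \<noteq> 0"
  shows "log_deriv (F * G) = log_deriv F + log_deriv G"
proof -
  have "F * inverse F = 1" "G * inverse G = 1"
    using assms by (simp_all add: inverse_mult_eq_1')
  moreover have "log_deriv (F * G) =
     fps_X * fps_deriv F * inverse F * (G * inverse G) + fps_X * fps_deriv G * inverse G * (F * inverse F)"
    by (simp add: log_deriv_def fps_inverse_mult algebra_simps)
  ultimately show ?thesis by (simp add: log_deriv_def)
qed

lemma log_deriv_1 [simp]: "log_deriv 1 = 0"
  by (simp add: log_deriv_def)

lemma log_deriv_inverse:
  assumes "F $ 0 \<noteq> 0"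
  shows "log_deriv (inverse F) = - log_deriv F"
  using log_deriv_mult[of F "inverse F"] assms
  by (simp add: inverse_mult_eq_1' eq_neg_iff_add_eq_0 add.commute)

lemma log_deriv_power:
  assumes "F $ 0 \<noteq> 0"
  shows "log_deriv (F ^ n) = of_nat n * log_deriv F"
  using assms by (induction n) (auto simp: log_deriv_mult fps_power_zeroth algebra_simps)

lemma log_deriv_one_minus_X_power_nth:
  assumes "0 < m" "0 < j"
  shows "log_deriv (1 - fps_X ^ m) $ j = (if m dvd j then - of_nat m else 0)"
proof -
  let ?G = "Abs_fps (\<lambda>j. if 0 < j \<and> m dvd j then - of_nat m else 0 :: rat)"
  have "?G * (1 - fps_X ^ m) = - (of_nat m * fps_X ^ m)"
  proof (rule fps_ext)
    fix i
    have "(?G * (1 - fps_X ^ m)) $ i = ?G $ i - (if i < m then 0 else ?G $ (i - m))"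
      by (simp add: right_diff_distrib fps_X_power_mult_right_nth)
    also have "\<dots> = - (of_nat m * fps_X ^ m) $ i"
      using assms by (cases "i < m") (auto simp: fps_of_nat[symmetric] dvd_minus_self dest: dvd_imp_le)
    finally show "(?G * (1 - fps_X ^ m)) $ i = (- (of_nat m * fps_X ^ m)) $ i" by simp
  qed
  moreover have "fps_X * fps_deriv (1 - fps_X ^ m) = - (of_nat m * fps_X ^ m :: rat fps)"
  proof (rule fps_ext)
    fix i
    show "(fps_X * fps_deriv (1 - fps_X ^ m)) $ i = (- (of_nat m * fps_X ^ m) :: rat fps) $ i"
      using assms by (cases i) (auto simp: fps_of_nat[symmetric])
  qed
  ultimately have "log_deriv (1 - fps_X ^ m) = ?G * ((1 - fps_X ^ m) * inverse (1 - fps_X ^ m))"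
    by (simp add: log_deriv_def mult.assoc[symmetric])
  also have "(1 - fps_X ^ m) * inverse (1 - fps_X ^ m) = (1 :: rat fps)"
    using assms by (intro inverse_mult_eq_1') simp
  finally show ?thesis using assms by simp
qed

lemma log_deriv_qpoch_nth:
  assumes "0 < k" "0 < j"
  shows "log_deriv (qpoch k n) $ j = - of_nat (\<Sum>i\<in>{i\<in>{1..n}. k * i dvd j}. k * i)"
proof (induction n)
  case 0
  then show ?case by (simp add: qpoch_def)
next
  case (Suc n)
  have "{i\<in>{1..Suc n}. k * i dvd j} = (if k * Suc n dvd j then insert (Suc n) {i\<in>{1..n}. k * i dvd j}
      else {i\<in>{1..n}. k * i dvd j})" by (auto simp: le_Suc_eq)
  then have "(\<Sum>i\<in>{i\<in>{1..Suc n}. k * i dvd j}. k * i) =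
      (if k * Suc n dvd j then k * Suc n else 0) + (\<Sum>i\<in>{i\<in>{1..n}. k * i dvd j}. k * i)"
    by (auto split: if_splits)
  moreover have "log_deriv (qpoch k (Suc n)) $ j = log_deriv (qpoch k n) $ j
      - of_nat (if k * Suc n dvd j then k * Suc n else 0)"
    unfolding qpoch_Suc using assms
    by (subst log_deriv_mult) (auto simp: log_deriv_one_minus_X_power_nth)
  ultimately show ?case using Suc by (simp only: of_nat_add)
qed

text \<open>For a product of factors \<open>1 - q\<^sup>m\<close> the kernel of this recurrence is a divisor sum, by
\<open>log_deriv_qpoch_nth\<close>.\<close>

lemma log_deriv_recurrence:
  assumes "F $ 0 \<noteq> 0"
  shows "of_nat n * F $ n = (\<Sum>j\<in>{1..n}. log_deriv F $ j * F $ (n - j))"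
proof -
  have "fps_X * fps_deriv F = log_deriv F * F"
    using assms by (simp add: log_deriv_def mult.assoc inverse_mult_eq_1)
  then have "(fps_X * fps_deriv F) $ n = (\<Sum>j\<in>{0..n}. log_deriv F $ j * F $ (n - j))"
    by (simp add: fps_mult_nth)
  moreover have "(fps_X * fps_deriv F) $ n = of_nat n * F $ n" by (cases n) auto
  moreover have "log_deriv F $ 0 = 0" by (simp add: log_deriv_def)
  ultimately show ?thesis by (simp add: sum.atLeast_Suc_atMost)
qed

section \<open>A Liouville identity and the twisted divisor sum\<close>

definition chi3 :: "int \<Rightarrow> int" where
  "chi3 a = (if a mod 3 = 1 then 1 else if a mod 3 = 2 then -1 else 0)"

lemma chi3_minus: "chi3 (- a) = - chi3 a"
  unfolding chi3_def by presburger

lemma chi3_cong: "a mod 3 = b mod 3 \<Longrightarrow> chi3 a = chi3 b"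
  by (simp add: chi3_def)

lemma chi3_double: "chi3 (2 * a) = - chi3 a"
  unfolding chi3_def by presburger

text \<open>For fixed \<open>a\<close> prime to 3 the values \<open>b, b + a, b - a\<close> exhaust the residues modulo 3
and the character sums to zero over them. This expresses the indicator of \<open>3 dvd a\<close>, times
\<open>chi3 b\<close>, through characters of linear forms in \<open>a\<close> and \<open>b\<close>.\<close>

lemma chi3_sum_of_line:
  "chi3 b + chi3 (a + b) - chi3 (a - b) = (if 3 dvd a then 3 * chi3 b else 0)"
proof -
  have sum: "(a + b) mod 3 = (a mod 3 + b mod 3) mod 3" by (simp add: mod_add_eq)
  have diff: "(a - b) mod 3 = (a mod 3 - b mod 3) mod 3" by (simp add: mod_diff_eq)
  have "a mod 3 = 0 \<or> a mod 3 = 1 \<or> a mod 3 = 2" "b mod 3 = 0 \<or> b mod 3 = 1 \<or> b mod 3 = 2"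
    by presburger+
  then show ?thesis unfolding chi3_def sum diff dvd_eq_mod_eq_0
    by (elim disjE) simp_all
qed

definition quads :: "int \<Rightarrow> (int \<times> int \<times> int \<times> int) set" where
  "quads N = {(a, b, x, y). 0 < a \<and> 0 < b \<and> 0 < x \<and> 0 < y \<and> a * x + b * y = N}"

definition factor_pairs :: "int \<Rightarrow> (int \<times> int) set" where
  "factor_pairs N = {(m, d). 0 < m \<and> 0 < d \<and> m * d = N}"

lemma factor_pairs_bounds:
  assumes "(m, d) \<in> factor_pairs N"
  shows "m \<in> {1..N}" "d \<in> {1..N}"
proof -
  have "0 < m" "0 < d" "m * d = N" using assms by (auto simp: factor_pairs_def)
  moreover from this have "m * 1 \<le> m * d" "1 * d \<le> m * d"
    by (auto intro: mult_mono)
  ultimately show "m \<in> {1..N}" "d \<in> {1..N}" by auto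
qed

lemma finite_factor_pairs [simp]: "finite (factor_pairs N)"
  by (rule finite_subset[of _ "{1..N} \<times> {1..N}"]) (use factor_pairs_bounds in auto)

lemma bij_betw_quads:
  "bij_betw (\<lambda>(j, (a, x), (b, y)). (a, b, x, y))
     (SIGMA j:{1..N-1}. factor_pairs j \<times> factor_pairs (N - j)) (quads N)"
proof (rule bij_betw_byWitness[where f' = "\<lambda>(a, b, x, y). (a * x, (a, x), (b, y))"])
  show "(\<lambda>(a, b, x, y). (a * x, (a, x), (b, y))) ` quads N
      \<subseteq> (SIGMA j:{1..N-1}. factor_pairs j \<times> factor_pairs (N - j))"
  proof -
    have "a * x \<in> {1..N-1} \<and> (a, x) \<in> factor_pairs (a * x) \<and> (b, y) \<in> factor_pairs (N - a * x)"
      if "(a, b, x, y) \<in> quads N" for a b x y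
    proof -
      have *: "0 < a" "0 < b" "0 < x" "0 < y" "a * x + b * y = N" using that by (auto simp: quads_def)
      then have "0 < a * x" "0 < b * y" by simp_all
      then have "a * x \<in> {1..N-1}" using *(5) unfolding atLeastAtMost_iff by linarith
      with * show ?thesis by (simp add: factor_pairs_def)
    qed
    then show ?thesis by auto
  qed
qed (auto simp: quads_def factor_pairs_def)

lemma finite_quads [simp]: "finite (quads N)"
  using bij_betw_finite[OF bij_betw_quads[of N]] by auto

lemma sum_quads_product:
  fixes f g :: "int \<Rightarrow> int \<Rightarrow> int"
  shows "(\<Sum>(a, b, x, y)\<in>quads N. f a x * g b y) =
    (\<Sum>j\<in>{1..N-1}. (\<Sum>(a, x)\<in>factor_pairs j. f a x) * (\<Sum>(b, y)\<in>factor_pairs (N - j). g b y))"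
proof -
  have "(\<Sum>(a, b, x, y)\<in>quads N. f a x * g b y) =
      (\<Sum>(j, (a, x), (b, y))\<in>(SIGMA j:{1..N-1}. factor_pairs j \<times> factor_pairs (N - j)). f a x * g b y)"
    by (subst sum.reindex_bij_betw[OF bij_betw_quads, symmetric])
       (auto intro!: sum.cong)
  also have "\<dots> = (\<Sum>j\<in>{1..N-1}. \<Sum>((a, x), (b, y))\<in>factor_pairs j \<times> factor_pairs (N - j). f a x * g b y)"
    by (subst sum.Sigma) auto
  also have "\<dots> = (\<Sum>j\<in>{1..N-1}. (\<Sum>(a, x)\<in>factor_pairs j. f a x) * (\<Sum>(b, y)\<in>factor_pairs (N - j). g b y))"
    by (simp add: sum_product sum.cartesian_product case_prod_unfold)
  finally show ?thesis .
qed

lemma sum_quads_swap: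
  fixes f :: "int \<Rightarrow> int \<Rightarrow> int \<Rightarrow> int \<Rightarrow> int"
  shows "(\<Sum>(a, b, x, y)\<in>quads N. f a b x y) = (\<Sum>(a, b, x, y)\<in>quads N. f b a y x)"
  by (rule sum.reindex_bij_witness[where i = "\<lambda>(a, b, x, y). (b, a, y, x)"
        and j = "\<lambda>(a, b, x, y). (b, a, y, x)"]) (auto simp: quads_def)

text \<open>The shears \<open>(a, b, x, y) \<mapsto> (a - b, b, x, x + y)\<close> and
\<open>(a, b, x, y) \<mapsto> (a, b - a, x + y, y)\<close> preserve \<open>a x + b y\<close>. They map the
quadruples with \<open>a > b\<close> onto those with \<open>y > x\<close>, and those with \<open>a < b\<close> onto those
with \<open>x > y\<close>. The invariance of \<open>g\<close> says that both shears turn \<open>g\<close> into the same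
function, so only the diagonals \<open>a = b\<close> and \<open>x = y\<close> survive.\<close>

lemma liouville_identity:
  fixes g :: "int \<Rightarrow> int \<Rightarrow> int \<Rightarrow> int \<Rightarrow> int"
  assumes inv: "\<And>a b x y. g (a - b) a (- y) (x + y) = g a b x y"
  shows "(\<Sum>(a, b, x, y)\<in>quads N. g a b x y - g (a + b) b x (y - x)) =
     (\<Sum>(a, b, x, y)\<in>{(a, b, x, y)\<in>quads N. a = b}. g a b x y)
   - (\<Sum>(a, b, x, y)\<in>{(a, b, x, y)\<in>quads N. x = y}. g (a + b) b x (y - x))"
proof -
  have trichotomy: "(\<Sum>q\<in>quads N. f q) = (\<Sum>q\<in>{q\<in>quads N. u q < v q}. f q)
      + (\<Sum>q\<in>{q\<in>quads N. v q < u q}. f q) + (\<Sum>q\<in>{q\<in>quads N. u q = v q}. f q)"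
    for u v f :: "int \<times> int \<times> int \<times> int \<Rightarrow> int"
  proof -
    have "quads N = {q\<in>quads N. u q < v q} \<union> {q\<in>quads N. v q < u q} \<union> {q\<in>quads N. u q = v q}"
      by auto
    then have "sum f (quads N) =
       sum f ({q\<in>quads N. u q < v q} \<union> {q\<in>quads N. v q < u q} \<union> {q\<in>quads N. u q = v q})" by simp
    also have "\<dots> = sum f ({q\<in>quads N. u q < v q} \<union> {q\<in>quads N. v q < u q}) + sum f {q\<in>quads N. u q = v q}"
      by (rule sum.union_disjoint) auto
    also have "sum f ({q\<in>quads N. u q < v q} \<union> {q\<in>quads N. v q < u q})
        = sum f {q\<in>quads N. u q < v q} + sum f {q\<in>quads N. v q < u q}"
      by (rule sum.union_disjoint) auto
    finally show ?thesis .
  qed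
  have shear1: "(\<Sum>(a, b, x, y)\<in>{(a, b, x, y)\<in>quads N. b < a}. g a b x y) =
      (\<Sum>(a, b, x, y)\<in>{(a, b, x, y)\<in>quads N. x < y}. g (a + b) b x (y - x))"
    by (rule sum.reindex_bij_witness[where i = "\<lambda>(a, b, x, y). (a + b, b, x, y - x)"
        and j = "\<lambda>(a, b, x, y). (a - b, b, x, x + y)"]) (auto simp: quads_def algebra_simps)
  have "(\<Sum>(a, b, x, y)\<in>{(a, b, x, y)\<in>quads N. a < b}. g a b x y) =
      (\<Sum>(a, b, x, y)\<in>{(a, b, x, y)\<in>quads N. y < x}. g a (a + b) (x - y) y)"
    by (rule sum.reindex_bij_witness[where i = "\<lambda>(a, b, x, y). (a, a + b, x - y, y)"
        and j = "\<lambda>(a, b, x, y). (a, b - a, x + y, y)"]) (auto simp: quads_def algebra_simps)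
  also have "\<dots> = (\<Sum>(a, b, x, y)\<in>{(a, b, x, y)\<in>quads N. y < x}. g (a + b) b x (y - x))"
  proof -
    have "g a (a + b) (x - y) y = g (a + b) b x (y - x)" for a b x y
      using inv[where a = "a + b" and b = b and x = x and y = "y - x"] by simp
    then show ?thesis by simp
  qed
  finally have shear2: "(\<Sum>(a, b, x, y)\<in>{(a, b, x, y)\<in>quads N. a < b}. g a b x y) =
      (\<Sum>(a, b, x, y)\<in>{(a, b, x, y)\<in>quads N. y < x}. g (a + b) b x (y - x))" .
  have "(\<Sum>(a, b, x, y)\<in>quads N. g a b x y) =
     (\<Sum>(a, b, x, y)\<in>{(a, b, x, y)\<in>quads N. a < b}. g a b x y)
   + (\<Sum>(a, b, x, y)\<in>{(a, b, x, y)\<in>quads N. b < a}. g a b x y)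
   + (\<Sum>(a, b, x, y)\<in>{(a, b, x, y)\<in>quads N. a = b}. g a b x y)"
    using trichotomy[of "\<lambda>(a, b, x, y). g a b x y" "\<lambda>(a, b, x, y). a" "\<lambda>(a, b, x, y). b"]
    by (simp add: case_prod_unfold)
  moreover have "(\<Sum>(a, b, x, y)\<in>quads N. g (a + b) b x (y - x)) =
     (\<Sum>(a, b, x, y)\<in>{(a, b, x, y)\<in>quads N. x < y}. g (a + b) b x (y - x))
   + (\<Sum>(a, b, x, y)\<in>{(a, b, x, y)\<in>quads N. y < x}. g (a + b) b x (y - x))
   + (\<Sum>(a, b, x, y)\<in>{(a, b, x, y)\<in>quads N. x = y}. g (a + b) b x (y - x))"
    using trichotomy[of "\<lambda>(a, b, x, y). g (a + b) b x (y - x)" "\<lambda>(a, b, x, y). x" "\<lambda>(a, b, x, y). y"]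
    by (simp add: case_prod_unfold)
  ultimately show ?thesis
    using shear1 shear2 by (simp add: sum_subtractf case_prod_unfold)
qed

definition chi_divisor_sum :: "int \<Rightarrow> int" where
  "chi_divisor_sum N = (\<Sum>(m, d)\<in>factor_pairs N. chi3 m * d\<^sup>2)"

text \<open>These are the coefficients of \<open>q d/dq\<close> of the logarithm of
\<open>f\<^sub>3\<^sup>9 / f\<^sub>1\<^sup>3\<close>, that is \<open>3 \<sigma>(j) - 27 \<sigma>(j / 3)\<close>, written as one sum over
factorisations so that products with \<open>chi_divisor_sum\<close> become sums over quadruples.\<close>

definition eta_weight :: "int \<Rightarrow> int" where
  "eta_weight j = (\<Sum>(a, x)\<in>factor_pairs j. 3 * x * (if 3 dvd a then -8 else 1))"

text \<open>The polynomial is what the function \<open>g\<close> of the next proof leaves on the diagonal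
\<open>a = b\<close>, where \<open>d = x + y\<close> is split in all ways; the coefficient 5 is the one for which
the cubic terms in \<open>d\<close> cancel.\<close>

lemma sum_over_two_part_splittings:
  "(\<Sum>x\<in>{1..d-1}. (x::int) * (d - x) * 5 - (d - x)^2 - x * d) = d * d - d" if "d > 0"
proof -
  have "(\<Sum>x\<in>{1..int n}. x * (D - x) * 5 - (D - x)\<^sup>2 - x * D) =
     3 * D * int n * (int n + 1) - int n * (int n + 1) * (2 * int n + 1) - int n * D\<^sup>2" for n D
  proof (induction n)
    case (Suc n)
    have "{1..int (Suc n)} = insert (int n + 1) {1..int n}" by auto
    then have "(\<Sum>x\<in>{1..int (Suc n)}. x * (D - x) * 5 - (D - x)\<^sup>2 - x * D)
      = (int n + 1) * (D - (int n + 1)) * 5 - (D - (int n + 1))\<^sup>2 - (int n + 1) * D +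
        (3 * D * int n * (int n + 1) - int n * (int n + 1) * (2 * int n + 1) - int n * D\<^sup>2)"
      using Suc by simp
    moreover have "int (Suc n) = int n + 1" by simp
    ultimately show ?case by algebra
  qed simp
  from this[where n = "nat (d - 1)" and D = d] that show ?thesis
    by (simp add: algebra_simps power2_eq_square)
qed

text \<open>The convolution on the right is the sum over quadruples of a function \<open>t\<close>, which is cubic in
\<open>(x, y)\<close> and depends on \<open>(a, b)\<close> through characters of linear forms. Liouville's identity
applies once \<open>t\<close> is written as \<open>g - h\<close>, with \<open>h\<close> the sheared \<open>g\<close>, up to a part
that is antisymmetric under exchanging \<open>(a, x)\<close> with \<open>(b, y)\<close>. Cubic coefficients for
\<open>g\<close> are found by solving a linear system; its solutions form a family, and the one used here
has few terms. The diagonals then yield the left side.\<close>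

lemma chi_divisor_sum_recurrence:
  "(N - 1) * chi_divisor_sum N = (\<Sum>j\<in>{1..N-1}. eta_weight j * chi_divisor_sum (N - j))"
proof -
  define g where "g a b x y = - y\<^sup>2 * (x + y) * chi3 b - x * (x + y)\<^sup>2 * chi3 a
    + x\<^sup>2 * y * chi3 (a - b) - 5 * x * y * (x + y) * chi3 (a + b)" for a b x y
  define h where "h a b x y = g (a + b) b x (y - x)" for a b x y
  define t where "t a b x y = 3 * x * (if 3 dvd a then -8 else 1) * (chi3 b * y\<^sup>2)" for a b x y :: int
  \<comment> \<open>The substitution has order 6. It permutes the characters of \<open>a\<close>, \<open>b\<close>, \<open>a - b\<close> up to sign, and maps that of \<open>a + b\<close> to its negative.\<close>
  have inv: "g (a - b) a (- y) (x + y) = g a b x y" for a b x y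
  proof -
    have "chi3 (a - b - a) = - chi3 b" using chi3_minus[of b] by simp
    moreover have "chi3 (a - b + a) = - chi3 (a + b)"
      unfolding chi3_minus[symmetric] by (rule chi3_cong) presburger
    ultimately show ?thesis unfolding g_def by algebra
  qed
  have t_eq: "t a b x y = x * y\<^sup>2 * (9 * chi3 (a - b) - 6 * chi3 b - 9 * chi3 (a + b))" for a b x y
  proof -
    have "3 * (if 3 dvd a then -8 else 1) * chi3 b = 9 * chi3 (a - b) - 6 * chi3 b - 9 * chi3 (a + b)"
      using chi3_sum_of_line[of b a] by (auto split: if_splits)
    then show ?thesis unfolding t_def by algebra
  qed
  have h_eq: "h a b x y = - (y - x)\<^sup>2 * y * chi3 b - x * y\<^sup>2 * chi3 (a + b)
     + x\<^sup>2 * (y - x) * chi3 a - 5 * x * (y - x) * y * chi3 (a - b)" for a b x y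
  proof -
    have "chi3 (a + b + b) = chi3 (a - b)" by (rule chi3_cong) presburger
    then show ?thesis unfolding h_def g_def by (simp add: algebra_simps power2_eq_square)
  qed
  \<comment> \<open>The identity \<open>t = g - h\<close> holds only after symmetrising.\<close>
  have "g a b x y - h a b x y + (g b a y x - h b a y x) = t a b x y + t b a y x" for a b x y
  proof -
    have "chi3 (b - a) = - chi3 (a - b)" using chi3_minus[of "a - b"] by simp
    then show ?thesis
      unfolding h_eq t_eq unfolding g_def add.commute[of b a] by algebra
  qed
  then have "(\<Sum>(a, b, x, y)\<in>quads N. g a b x y - h a b x y + (g b a y x - h b a y x)) =
      (\<Sum>(a, b, x, y)\<in>quads N. t a b x y + t b a y x)" by simp
  moreover have "(\<Sum>(a, b, x, y)\<in>quads N. f a b x y + f b a y x) = 2 * (\<Sum>(a, b, x, y)\<in>quads N. f a b x y)"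
    for f :: "int \<Rightarrow> int \<Rightarrow> int \<Rightarrow> int \<Rightarrow> int"
    using sum_quads_swap[of f N] by (simp add: case_prod_unfold sum.distrib)
  note this[of "\<lambda>a b x y. g a b x y - h a b x y"] this[of t]
  ultimately have "(\<Sum>(a, b, x, y)\<in>quads N. t a b x y) = (\<Sum>(a, b, x, y)\<in>quads N. g a b x y - h a b x y)"
    by simp
  also have "\<dots> = (\<Sum>(a, b, x, y)\<in>{(a, b, x, y)\<in>quads N. a = b}. g a b x y)
   - (\<Sum>(a, b, x, y)\<in>{(a, b, x, y)\<in>quads N. x = y}. h a b x y)"
    unfolding h_def by (rule liouville_identity) (rule inv)
  also have "(\<Sum>(a, b, x, y)\<in>{(a, b, x, y)\<in>quads N. a = b}. g a b x y)
      = (\<Sum>(m, d)\<in>factor_pairs N. chi3 m * d\<^sup>2 * (d - 1))"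
  proof -
    have "(\<Sum>(a, b, x, y)\<in>{(a, b, x, y)\<in>quads N. a = b}. g a b x y)
       = (\<Sum>((m, d), x)\<in>(SIGMA (m, d):factor_pairs N. {1..d - 1}). g m m x (d - x))"
      by (rule sum.reindex_bij_witness[where i = "\<lambda>((m, d), x). (m, m, x, d - x)"
        and j = "\<lambda>(a, b, x, y). ((a, x + y), x)"]) (auto simp: quads_def factor_pairs_def algebra_simps)
    also have "\<dots> = (\<Sum>(m, d)\<in>factor_pairs N. \<Sum>x\<in>{1..d - 1}. g m m x (d - x))"
      by (subst sum.Sigma[symmetric]) (auto simp: case_prod_unfold)
    also have "\<dots> = (\<Sum>(m, d)\<in>factor_pairs N. chi3 m * d\<^sup>2 * (d - 1))"
    proof (intro sum.cong refl, clarify)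
      fix m d assume "(m, d) \<in> factor_pairs N"
      then have "d > 0" by (simp add: factor_pairs_def)
      have "g m m x (d - x) = chi3 m * d * (x * (d - x) * 5 - (d - x)^2 - x * d)" for x
      proof -
        have "chi3 (m + m) = - chi3 m" unfolding mult_2[symmetric] by (rule chi3_double)
        moreover have "chi3 (m - m) = 0" by (simp add: chi3_def)
        ultimately show ?thesis unfolding g_def by algebra
      qed
      then have "(\<Sum>x\<in>{1..d - 1}. g m m x (d - x)) = chi3 m * d * (d * d - d)"
        using sum_over_two_part_splittings[OF \<open>d > 0\<close>] by (simp add: sum_distrib_left[symmetric])
      then show "(\<Sum>x\<in>{1..d - 1}. g m m x (d - x)) = chi3 m * d\<^sup>2 * (d - 1)" by algebra
    qed
    finally show ?thesis .
  qed
  also have "(\<Sum>(a, b, x, y)\<in>{(a, b, x, y)\<in>quads N. x = y}. h a b x y)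
      = (\<Sum>(m, d)\<in>factor_pairs N. - (chi3 m * d ^ 3 * (m - 1)))"
  proof -
    have "(\<Sum>(a, b, x, y)\<in>{(a, b, x, y)\<in>quads N. x = y}. h a b x y)
       = (\<Sum>((m, d), a)\<in>(SIGMA (m, d):factor_pairs N. {1..m - 1}). h a (m - a) d d)"
      by (rule sum.reindex_bij_witness[where i = "\<lambda>((m, d), a). (a, m - a, d, d)"
        and j = "\<lambda>(a, b, x, y). ((a + b, x), a)"]) (auto simp: quads_def factor_pairs_def algebra_simps)
    also have "\<dots> = (\<Sum>(m, d)\<in>factor_pairs N. \<Sum>a\<in>{1..m - 1}. h a (m - a) d d)"
      by (subst sum.Sigma[symmetric]) (auto simp: case_prod_unfold)
    also have "\<dots> = (\<Sum>(m, d)\<in>factor_pairs N. - (chi3 m * d ^ 3 * (m - 1)))"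
      by (intro sum.cong refl, clarify)
         (auto simp: h_eq factor_pairs_def power2_eq_square power3_eq_cube)
    finally show ?thesis .
  qed
  finally have "(\<Sum>(a, b, x, y)\<in>quads N. t a b x y) =
      (\<Sum>(m, d)\<in>factor_pairs N. chi3 m * d\<^sup>2 * (d - 1) + chi3 m * d ^ 3 * (m - 1))"
    by (simp add: sum_negf sum.distrib case_prod_unfold)
  also have "\<dots> = (\<Sum>(m, d)\<in>factor_pairs N. (N - 1) * (chi3 m * d\<^sup>2))"
    by (intro sum.cong refl)
       (auto simp: factor_pairs_def power2_eq_square power3_eq_cube algebra_simps)
  also have "\<dots> = (N - 1) * chi_divisor_sum N"
    by (simp add: chi_divisor_sum_def sum_distrib_left case_prod_unfold)
  also have "(\<Sum>(a, b, x, y)\<in>quads N. t a b x y) = (\<Sum>j\<in>{1..N-1}. eta_weight j * chi_divisor_sum (N - j))"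
    unfolding t_def eta_weight_def chi_divisor_sum_def
    by (rule sum_quads_product[where f = "\<lambda>a x. 3 * x * (if 3 dvd a then -8 else 1)" and g = "\<lambda>b y. chi3 b * y\<^sup>2"])
  finally show ?thesis by simp
qed

section \<open>Counting triples of 3-cores by the twisted divisor sum\<close>

lemma finite_cores: "finite {xs. is_core t xs \<and> sum_list xs = n}"
proof (rule finite_subset)
  show "{xs. is_core t xs \<and> sum_list xs = n} \<subseteq> fst ` core_triples t n"
  proof
    fix xs assume "xs \<in> {xs. is_core t xs \<and> sum_list xs = n}"
    then have "(xs, [], []) \<in> core_triples t n"
      by (simp add: core_triples_def is_core_def is_partition_def cells_def)
    then show "xs \<in> fst ` core_triples t n" by (metis fst_conv image_eqI)
  qed
qed (simp add: finite_core_triples)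

lemma card_core_triples:
  fixes t :: nat
  defines "C \<equiv> \<lambda>i. {xs. is_core t xs \<and> sum_list xs = i}"
  shows "card (core_triples t n) =
    (\<Sum>(i, j, k)\<in>{(i, j, k). i + j + k = n}. card (C i) * card (C j) * card (C k))"
proof -
  let ?T = "SIGMA (i, j, k):{(i, j, k). i + j + k = n}. C i \<times> C j \<times> C k"
  have "bij_betw snd ?T (core_triples t n)"
    by (rule bij_betw_byWitness[where
          f' = "\<lambda>(xs, ys, zs). ((sum_list xs, sum_list ys, sum_list zs), (xs, ys, zs))"])
       (auto simp: core_triples_def C_def)
  then have "card (core_triples t n) = card ?T" by (simp add: bij_betw_same_card)
  also have "\<dots> = (\<Sum>(i, j, k)\<in>{(i, j, k). i + j + k = n}. card (C i) * card (C j) * card (C k))"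
    by (subst card_SigmaI, rule finite_triples)
       (auto simp: C_def finite_cores card_cartesian_product case_prod_unfold mult.assoc)
  finally show ?thesis .
qed

lemma sum_factor_pairs_dvd:
  assumes "0 < d" "0 < j" "j \<le> K"
  shows "(\<Sum>(a, x)\<in>{(a, x)\<in>factor_pairs (int j). int d dvd a}. x) =
    int (\<Sum>i\<in>{i\<in>{1..K}. d * i dvd j}. i)"
proof -
  have "(\<Sum>(a, x)\<in>{(a, x)\<in>factor_pairs (int j). int d dvd a}. x) =
    (\<Sum>i\<in>{i\<in>{1..K}. d * i dvd j}. int i)"
  proof (rule sum.reindex_bij_witness[where i = "\<lambda>i. (int (j div i), int i)" and j = "\<lambda>(a, x). nat x"])
    fix p assume "p \<in> {(a, x)\<in>factor_pairs (int j). int d dvd a}"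
    then obtain a x where p: "p = (a, x)" "0 < a" "0 < x" "a * x = int j" "int d dvd a"
      by (auto simp: factor_pairs_def)
    then obtain a' x' where n: "a = int a'" "x = int x'" by (meson zero_less_imp_eq_int)
    then have j: "j = a' * x'" using p(4) by (metis of_nat_eq_iff of_nat_mult)
    have pos: "0 < x'" "d dvd a'" using p n by auto
    have "x' \<le> j" using j assms(2) by (cases a') auto
    then have "x' \<le> K" using assms(3) by (rule order_trans)
    then show "(case p of (a, x) \<Rightarrow> nat x) \<in> {i\<in>{1..K}. d * i dvd j}"
      using p(1) n pos by (auto simp: j intro: mult_dvd_mono)
    show "(case case p of (a, x) \<Rightarrow> nat x of i \<Rightarrow> (int (j div i), int i)) = p"
      using p(1) n pos by (simp add: j)
    show "int (case p of (a, x) \<Rightarrow> nat x) = (case p of (a, x) \<Rightarrow> x)"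
      using p(1) n by simp
  next
    fix i assume i: "i \<in> {i\<in>{1..K}. d * i dvd j}"
    then obtain e where e: "j = d * i * e" by auto
    then have "j div i = d * e" using i by auto
    moreover have "0 < e" using e assms(2) by (cases e) auto
    ultimately show "(int (j div i), int i) \<in> {(a, x)\<in>factor_pairs (int j). int d dvd a}"
      using i assms(1) by (auto simp: factor_pairs_def e)
  qed auto
  then show ?thesis by simp
qed

lemma eta_weight_eq:
  assumes "0 < j" "j \<le> K"
  shows "eta_weight (int j) =
    3 * int (\<Sum>i\<in>{i\<in>{1..K}. 1 * i dvd j}. i) - 27 * int (\<Sum>i\<in>{i\<in>{1..K}. 3 * i dvd j}. i)"
proof -
  have "(\<Sum>(a, x)\<in>factor_pairs (int j). if 3 dvd a then x else 0) =
      (\<Sum>(a, x)\<in>{(a, x)\<in>factor_pairs (int j). int 3 dvd a}. x)"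
    by (rule sum.mono_neutral_cong_right) (auto split: if_splits)
  moreover have "eta_weight (int j) = (\<Sum>(a, x)\<in>factor_pairs (int j). 3 * x - 27 * (if 3 dvd a then x else 0))"
    unfolding eta_weight_def by (intro sum.cong) auto
  ultimately show ?thesis
    using sum_factor_pairs_dvd[OF _ assms, of 1] sum_factor_pairs_dvd[OF _ assms, of 3]
    by (simp add: sum_subtractf sum_distrib_left[symmetric] case_prod_unfold)
qed

text \<open>The truncation at \<open>9 n\<close> beads is \<open>3 M\<close> with \<open>M = 3 n\<close>, which suffices for all
coefficients up to \<open>n\<close>.\<close>

lemma B3_eq_eta_quotient_nth:
  assumes "m \<le> n"
  shows "rat_of_nat (B3 m) = ((qpoch 3 (9 * n) ^ 3 * inverse (qpoch 1 (9 * n))) ^ 3) $ m"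
proof -
  let ?R = "qpoch 3 (9 * n) ^ 3 * inverse (qpoch 1 (9 * n))"
  have "?R $ j = of_nat (card {xs. is_core 3 xs \<and> sum_list xs = j})" if "j \<le> n" for j
    using theta_eq_eta_quotient[of n "3 * n" j] card_three_cores[of j "3 * (3 * n)"] that by simp
  then have "(?R * ?R * ?R) $ m = of_nat (card (core_triples 3 m))"
    unfolding fps_mult3_nth card_core_triples using assms by (auto simp: of_nat_sum intro!: sum.cong)
  then show ?thesis by (simp add: B3_def power3_eq_cube)
qed

lemma B3_recurrence:
  "int n * int (B3 n) = (\<Sum>j\<in>{1..n}. eta_weight (int j) * int (B3 (n - j)))"
proof -
  define Q P where "Q = qpoch 3 (9 * n)" and "P = qpoch 1 (9 * n)"
  define R where "R = (Q ^ 3 * inverse P) ^ 3"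
  have "Q $ 0 = 1" "P $ 0 = 1" by (simp_all add: Q_def P_def)
  then have "log_deriv R = 3 * (3 * log_deriv Q - log_deriv P)" "R $ 0 \<noteq> 0"
    by (simp_all add: R_def log_deriv_power log_deriv_mult log_deriv_inverse fps_power_zeroth)
  moreover have "log_deriv Q $ j = - of_nat (\<Sum>i\<in>{i\<in>{1..9 * n}. 3 * i dvd j}. 3 * i)"
    "log_deriv P $ j = - of_nat (\<Sum>i\<in>{i\<in>{1..9 * n}. 1 * i dvd j}. 1 * i)" if "1 \<le> j" for j
    unfolding Q_def P_def using that by (intro log_deriv_qpoch_nth; simp)+
  ultimately have log: "log_deriv R $ j = of_int (eta_weight (int j))" if "1 \<le> j" "j \<le> n" for j
    using that eta_weight_eq[of j "9 * n"]
    by (simp add: numeral_fps_const sum_distrib_left[symmetric])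
  have B3: "rat_of_nat (B3 m) = R $ m" if "m \<le> n" for m
    using B3_eq_eta_quotient_nth[OF that] unfolding R_def Q_def P_def .
  have "of_nat n * R $ n = (\<Sum>j\<in>{1..n}. log_deriv R $ j * R $ (n - j))"
    using \<open>R $ 0 \<noteq> 0\<close> by (rule log_deriv_recurrence)
  then have "of_nat n * rat_of_nat (B3 n) = (\<Sum>j\<in>{1..n}. of_int (eta_weight (int j)) * rat_of_nat (B3 (n - j)))"
    by (simp add: B3 log)
  then have "rat_of_int (int n * int (B3 n)) = rat_of_int (\<Sum>j\<in>{1..n}. eta_weight (int j) * int (B3 (n - j)))"
    by simp
  then show ?thesis by (simp only: of_int_eq_iff)
qed

text \<open>Both sides satisfy the same recurrence with the same initial value. It is
the expansion of \<open>q f\<^sub>3\<^sup>9 / f\<^sub>1\<^sup>3\<close> as an Eisenstein series of weight 3.\<close>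

theorem B3_eq_chi_divisor_sum: "int (B3 n) = chi_divisor_sum (int n + 1)"
proof (induction n rule: less_induct)
  case (less n)
  show ?case
  proof (cases "n = 0")
    case True
    have "factor_pairs 1 = {(1, 1)}"
      by (auto simp: factor_pairs_def zmult_eq_1_iff)
    moreover have "B3 0 = 1" using B3_eq_eta_quotient_nth[of 0 0] by (simp add: qpoch_def)
    ultimately show ?thesis using True by (simp add: chi_divisor_sum_def chi3_def)
  next
    case False
    have "int n * chi_divisor_sum (int n + 1) =
        (\<Sum>j\<in>{1..int n}. eta_weight j * chi_divisor_sum (int n + 1 - j))"
      using chi_divisor_sum_recurrence[of "int n + 1"] by simp
    also have "{1..int n} = int ` {1..n}" by (simp add: image_int_atLeastAtMost)
    also have "(\<Sum>j\<in>int ` {1..n}. eta_weight j * chi_divisor_sum (int n + 1 - j)) =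
        (\<Sum>j\<in>{1..n}. eta_weight (int j) * chi_divisor_sum (int n + 1 - int j))"
      by (subst sum.reindex) (auto simp: inj_on_def)
    also have "\<dots> = (\<Sum>j\<in>{1..n}. eta_weight (int j) * int (B3 (n - j)))"
    proof (rule sum.cong[OF refl])
      fix j assume "j \<in> {1..n}"
      then have "n - j < n" "int n + 1 - int j = int (n - j) + 1" by auto
      then show "eta_weight (int j) * chi_divisor_sum (int n + 1 - int j) = eta_weight (int j) * int (B3 (n - j))"
        by (simp only: less.IH)
    qed
    also have "\<dots> = int n * int (B3 n)" by (rule B3_recurrence[symmetric])
    finally show ?thesis using False by simp
  qed
qed

section \<open>Powers of two\<close>

lemma chi3_power_2_mult: "chi3 (2 ^ j * a) = (-1) ^ j * chi3 a"
  by (induction j) (auto simp: chi3_double mult.assoc)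

text \<open>The factorisations \<open>a d\<close> of \<open>2\<^bsup>k+1\<^esup> m\<close> with \<open>d\<close> even come from those of
\<open>2\<^sup>k m\<close> by doubling \<open>d\<close>; in those with \<open>d\<close> odd the whole power of two sits in
\<open>a\<close>, where each factor 2 changes the sign of the character.\<close>

lemma chi_divisor_sum_double:
  assumes "odd m"
  shows "chi_divisor_sum (2 ^ Suc k * m) = 4 * chi_divisor_sum (2 ^ k * m) + (-1) ^ Suc k * chi_divisor_sum m"
proof -
  let ?F = "factor_pairs (2 ^ Suc k * m)"
  let ?f = "\<lambda>(a, d). chi3 a * d\<^sup>2"
  have "?F = {(a, d)\<in>?F. even d} \<union> {(a, d)\<in>?F. odd d}" by auto
  then have "chi_divisor_sum (2 ^ Suc k * m) = sum ?f ({(a, d)\<in>?F. even d} \<union> {(a, d)\<in>?F. odd d})"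
    unfolding chi_divisor_sum_def by simp
  also have "\<dots> = sum ?f {(a, d)\<in>?F. even d} + sum ?f {(a, d)\<in>?F. odd d}"
    by (rule sum.union_disjoint) (auto intro: finite_subset[of _ ?F])
  also have "sum ?f {(a, d)\<in>?F. even d} = (\<Sum>(a, d)\<in>factor_pairs (2 ^ k * m). 4 * (chi3 a * d\<^sup>2))"
    by (rule sum.reindex_bij_witness[where i = "\<lambda>(a, d). (a, 2 * d)" and j = "\<lambda>(a, d). (a, d div 2)"])
       (auto simp: factor_pairs_def power_mult_distrib elim!: evenE)
  also have "\<dots> = 4 * chi_divisor_sum (2 ^ k * m)"
    by (simp add: chi_divisor_sum_def sum_distrib_left case_prod_unfold)
  also have "sum ?f {(a, d)\<in>?F. odd d} = (\<Sum>(a, d)\<in>factor_pairs m. (-1) ^ Suc k * (chi3 a * d\<^sup>2))"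
  proof -
    have dvd: "2 ^ Suc k dvd a" if "a * d = 2 ^ Suc k * m" "odd d" for a d :: int
    proof -
      have "coprime (2 ^ Suc k) d" using that(2) by (simp add: coprime_commute)
      moreover have "2 ^ Suc k dvd a * d" unfolding that(1) by simp
      ultimately show ?thesis using coprime_dvd_mult_left_iff by blast
    qed
    have odd: "odd d" if "a * d = m" for a d using that assms by auto
    show ?thesis
    proof (rule sum.reindex_bij_witness[where i = "\<lambda>(a, d). (2 ^ Suc k * a, d)"
          and j = "\<lambda>(a, d). (a div 2 ^ Suc k, d)"])
      fix p assume "p \<in> {(a, d)\<in>?F. odd d}"
      then obtain a d where p: "p = (a, d)" "0 < a" "0 < d" "a * d = 2 ^ Suc k * m" "odd d"
        by (auto simp: factor_pairs_def)
      obtain b where b: "a = 2 ^ Suc k * b" using dvd[OF p(4,5)] by auto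
      have "0 < b" using p(2) unfolding b by (simp add: zero_less_mult_iff)
      moreover have "b * d = m" using p(4) unfolding b by (simp add: mult.assoc)
      moreover have "a div 2 ^ Suc k = b" unfolding b by simp
      moreover have "chi3 a = (-1) ^ Suc k * chi3 b" unfolding b by (rule chi3_power_2_mult)
      ultimately show "(case case p of (a, d) \<Rightarrow> (a div 2 ^ Suc k, d) of (a, d) \<Rightarrow> (2 ^ Suc k * a, d)) = p"
        "(case p of (a, d) \<Rightarrow> (a div 2 ^ Suc k, d)) \<in> factor_pairs m"
        "(case case p of (a, d) \<Rightarrow> (a div 2 ^ Suc k, d) of (a, d) \<Rightarrow> (-1) ^ Suc k * (chi3 a * d\<^sup>2)) =
         (case p of (a, d) \<Rightarrow> chi3 a * d\<^sup>2)"
        using p(1,3) b by (simp_all only: prod.case factor_pairs_def mem_Collect_eq mult.assoc simp_thms)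
    next
      fix p assume "p \<in> factor_pairs m"
      then obtain a d where p: "p = (a, d)" "0 < a" "0 < d" "a * d = m" by (auto simp: factor_pairs_def)
      then show "(case case p of (a, d) \<Rightarrow> (2 ^ Suc k * a, d) of (a, d) \<Rightarrow> (a div 2 ^ Suc k, d)) = p"
        "(case p of (a, d) \<Rightarrow> (2 ^ Suc k * a, d)) \<in> {(a, d)\<in>?F. odd d}"
        using odd[OF p(4)] by (simp_all add: factor_pairs_def)
    qed
  qed
  also have "\<dots> = (-1) ^ Suc k * chi_divisor_sum m"
    by (simp add: chi_divisor_sum_def sum_distrib_left case_prod_unfold)
  finally show ?thesis .
qed

lemma chi_divisor_sum_power_2_mult:
  assumes "odd m"
  shows "5 * chi_divisor_sum (2 ^ k * m) = (2 ^ (2 * k + 2) + (-1) ^ k) * chi_divisor_sum m"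
proof (induction k)
  case (Suc k)
  have "5 * chi_divisor_sum (2 ^ Suc k * m) = 4 * (5 * chi_divisor_sum (2 ^ k * m)) - 5 * (-1) ^ k * chi_divisor_sum m"
    unfolding chi_divisor_sum_double[OF assms] by simp
  also have "\<dots> = (2 ^ (2 * Suc k + 2) + (-1) ^ Suc k) * chi_divisor_sum m"
    unfolding Suc.IH by (simp add: algebra_simps)
  finally show ?case .
qed simp

theorem corollary2p1:
  fixes k n :: nat
  assumes "k \<ge> 1"
  shows "[int (B3 (2 ^ (k + 1) * n + 2 ^ k - 1)) = 0] (mod ((2 ^ (2 * k + 2) + (-1) ^ k) div 5))"
proof -
  define c :: int where "c = (2 ^ (2 * k + 2) + (-1) ^ k) div 5"
  have c: "2 ^ (2 * k + 2) + (-1) ^ k = 5 * c"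
    unfolding c_def using five_dvd_modulus[of k] by (metis dvd_mult_div_cancel)
  have "int (2 ^ (k + 1) * n + 2 ^ k - 1) + 1 = 2 ^ k * (2 * int n + 1)"
  proof -
    have "1 \<le> 2 ^ (k + 1) * n + (2 :: nat) ^ k" by (simp add: Suc_le_eq)
    then have "int (2 ^ (k + 1) * n + 2 ^ k - 1) = int (2 ^ (k + 1) * n + 2 ^ k) - int 1"
      by (rule of_nat_diff)
    then show ?thesis by (simp add: algebra_simps)
  qed
  then have "int (B3 (2 ^ (k + 1) * n + 2 ^ k - 1)) = chi_divisor_sum (2 ^ k * (2 * int n + 1))"
    by (simp only: B3_eq_chi_divisor_sum)
  also have "\<dots> = c * chi_divisor_sum (2 * int n + 1)"
    using chi_divisor_sum_power_2_mult[of "2 * int n + 1" k] unfolding c by simp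
  finally show ?thesis unfolding c_def[symmetric] by (simp add: cong_0_iff)
qed

end
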